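(* All matchings in a graph $G=(V,E)$ can be enumerated in $O(1)$ (amortized) time for each, using $O(|E|+|V|)$ space.
   Context: A matching of $G$ is a subset of $E$ in which no two edges share an endpoint. The graph is given by adjacency lists. The time per solution is the total running time divided by the number of matchings. *)

theory Defs
  imports Complex_Main
begin

definition simple_graph :: "nat set \<Rightarrow> nat set set \<Rightarrow> bool" where
  "simple_graph V E \<longleftrightarrow> finite V \<and> (\<forall>e\<in>E. e \<subseteq> V \<and> card e = 2)"

definition matching :: "nat set set \<Rightarrow> nat set set \<Rightarrow> bool" where
  "matching E M \<longleftrightarrow> M \<subseteq> E \<and> (\<forall>e\<in>M. \<forall>f\<in>M. e \<noteq> f \<longrightarrow> e \<inter> f = {})"

text \<open>The vertices are numbered consecutively from 0, and the neighbours of a vertex may be listed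
  in any order.\<close>

definition adjacency_lists :: "nat set \<Rightarrow> nat set set \<Rightarrow> nat list list \<Rightarrow> bool" where
  "adjacency_lists V E adj \<longleftrightarrow>
     V = {..<length adj} \<and>
     (\<forall>v\<in>V. distinct (adj ! v) \<and> set (adj ! v) = {u. {u, v} \<in> E})"

text \<open>Memory layout of the input: the number of vertices, then a start index for each
  adjacency list together with a final sentinel (the total length of the lists), then the lists
  themselves, one after the other. Indices are relative to the beginning of the last part.\<close>

definition encode :: "nat list list \<Rightarrow> nat list" where
  "encode adj =
     length adj # map (\<lambda>v. sum_list (map length (take v adj))) [0..<Suc (length adj)] @ concat adj"


text \<open>The machine model is a random access machine with structured control flow. A program uses a
  fixed finite set of registers, a word-addressed memory and a write-only output tape. Every
  elementary instruction and every test costs one time unit.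

  The execution relation is parameterised by the word bound \<open>W\<close> (all words are less than \<open>W\<close>) and
  the memory size \<open>S\<close> (all addresses are less than \<open>S\<close>). A program that violates one of the two
  bounds gets stuck and has no execution at all.\<close>

datatype operand = Const nat | Reg nat

datatype cond = Less operand operand | Equal operand operand

datatype com =
    Skip
  | Add nat operand operand
  | Sub nat operand operand
  | Load nat operand
  | Store operand operand
  | Output operand
  | Seq com com
  | IfElse cond com com
  | While cond com

record state =
  regs :: "nat \<Rightarrow> nat"
  mem :: "nat \<Rightarrow> nat"
  out :: "nat list"

fun val :: "state \<Rightarrow> operand \<Rightarrow> nat" where
  "val s (Const k) = k"
| "val s (Reg x) = regs s x"

fun holds :: "state \<Rightarrow> cond \<Rightarrow> bool" where
  "holds s (Less a b) \<longleftrightarrow> val s a < val s b"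
| "holds s (Equal a b) \<longleftrightarrow> val s a = val s b"

definition set_reg :: "nat \<Rightarrow> nat \<Rightarrow> state \<Rightarrow> state" where
  "set_reg x w s = s\<lparr>regs := (regs s)(x := w)\<rparr>"

inductive exec :: "nat \<Rightarrow> nat \<Rightarrow> com \<Rightarrow> state \<Rightarrow> nat \<Rightarrow> state \<Rightarrow> bool" for W S :: nat where
  Skip: "exec W S Skip s 1 s"
| Add: "val s a + val s b < W \<Longrightarrow> exec W S (Add x a b) s 1 (set_reg x (val s a + val s b) s)"
| Sub: "val s a - val s b < W \<Longrightarrow> exec W S (Sub x a b) s 1 (set_reg x (val s a - val s b) s)"
| Load: "val s a < S \<Longrightarrow> mem s (val s a) < W \<Longrightarrow>
    exec W S (Load x a) s 1 (set_reg x (mem s (val s a)) s)"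
| Store: "val s a < S \<Longrightarrow> val s b < W \<Longrightarrow>
    exec W S (Store a b) s 1 (s\<lparr>mem := (mem s)(val s a := val s b)\<rparr>)"
| Output: "val s a < W \<Longrightarrow> exec W S (Output a) s 1 (s\<lparr>out := out s @ [val s a]\<rparr>)"
| Seq: "exec W S p s t s' \<Longrightarrow> exec W S q s' t' s'' \<Longrightarrow> exec W S (Seq p q) s (t + t') s''"
| IfTrue: "holds s b \<Longrightarrow> exec W S p s t s' \<Longrightarrow> exec W S (IfElse b p q) s (1 + t) s'"
| IfFalse: "\<not> holds s b \<Longrightarrow> exec W S q s t s' \<Longrightarrow> exec W S (IfElse b p q) s (1 + t) s'"
| WhileFalse: "\<not> holds s b \<Longrightarrow> exec W S (While b p) s 1 s"
| WhileTrue: "holds s b \<Longrightarrow> exec W S p s t s' \<Longrightarrow> exec W S (While b p) s' t' s'' \<Longrightarrow>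
    exec W S (While b p) s (1 + t + t') s''"

inductive_cases SeqE: "exec W S (Seq p q) s t s'"
inductive_cases IfElseE: "exec W S (IfElse b p q) s t s'"
inductive_cases WhileE: "exec W S (While b p) s t s'"

lemma exec_deterministic:
  "exec W S p s t s' \<Longrightarrow> exec W S p s u r \<Longrightarrow> u = t \<and> r = s'"
proof (induction arbitrary: u r rule: exec.induct)
  case (Seq p s t s' q t' s'')
  from Seq.prems show ?case
  proof (rule SeqE)
    fix u1 r1 u2
    assume u: "u = u1 + u2" and p: "exec W S p s u1 r1" and q: "exec W S q r1 u2 r"
    from Seq.IH(1)[OF p] q have "exec W S q s' u2 r" by simp
    from Seq.IH(2)[OF this] Seq.IH(1)[OF p] u show ?thesis by simp
  qed
next
  case (IfTrue s b p t s' q)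
  from IfTrue.prems show ?case
    by (rule IfElseE) (simp_all add: IfTrue.hyps(1) IfTrue.IH)
next
  case (IfFalse s b q t s' p)
  from IfFalse.prems show ?case
    by (rule IfElseE) (simp_all add: IfFalse.hyps(1) IfFalse.IH)
next
  case (WhileFalse s b p)
  from WhileFalse.prems show ?case
    by (rule WhileE) (simp_all add: WhileFalse.hyps)
next
  case (WhileTrue s b p t s' t' s'')
  from WhileTrue.prems show ?case
  proof (rule WhileE)
    assume "\<not> holds s b"
    with WhileTrue.hyps(1) show ?thesis by simp
  next
    fix u1 r1 u2
    assume u: "u = Suc (u1 + u2)" and p: "exec W S p s u1 r1"
      and w: "exec W S (While b p) r1 u2 r"
    from WhileTrue.IH(1)[OF p] w have "exec W S (While b p) s' u2 r" by simp
    from WhileTrue.IH(2)[OF this] WhileTrue.IH(1)[OF p] u show ?thesis by simp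
  qed
qed (erule exec.cases; simp)+

definition initial :: "nat list \<Rightarrow> state" where
  "initial ws =
     \<lparr>regs = (\<lambda>_. 0), mem = (\<lambda>i. if i < length ws then ws ! i else 0), out = []\<rparr>"


text \<open>Writing out every solution in full takes time proportional to the sum of their sizes, which
  is not constant per solution (for \<open>k\<close> disjoint edges the average size of a matching is
  \<open>k / 2\<close>). As usual in constant-time enumeration, the solutions are therefore output by differences.
  The output tape is a sequence of commands acting on a current edge set: \<open>0\<close> reports the current
  set as a solution, \<open>1 u v\<close> inserts the edge \<open>{u, v}\<close>, and \<open>2 u v\<close> removes it.
  \<open>reports M ws Ms\<close> states that \<open>ws\<close>, started with the edge set \<open>M\<close>, is well-formed and reports
  exactly the sets \<open>Ms\<close>, in this order.\<close>

inductive reports :: "nat set set \<Rightarrow> nat list \<Rightarrow> nat set set list \<Rightarrow> bool" where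
  finish: "reports M [] []"
| report: "reports M ws Ms \<Longrightarrow> reports M (0 # ws) (M # Ms)"
| insert: "reports (insert {u, v} M) ws Ms \<Longrightarrow> reports M (1 # u # v # ws) Ms"
| remove: "reports (M - {{u, v}}) ws Ms \<Longrightarrow> reports M (2 # u # v # ws) Ms"

end

theory Submission
  imports Defs "HOL-Library.Multiset"
begin

text \<open>The current graph is a prefix of an array of edges. To branch, take the first edge of the prefix
  and let \<open>v\<close> be its endpoint of larger degree \<open>d\<close>. Partition the prefix in place into the \<open>l\<close>
  edges avoiding \<open>v\<close>, followed by the \<open>d\<close> edges at \<open>v\<close>. Recurse on the first part (\<open>v\<close> stays
  unmatched), and then, for each edge \<open>e\<close> at \<open>v\<close>, partition the first part into the edges avoiding \<open>e\<close>
  and the others and recurse on the former. A recursive call permutes only its own prefix, so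
  nothing has to be undone on return, and the recursion needs a constant number of words per level.

  The work at such a node is \<open>O(l + d + d l)\<close>, and it is pushed to the children: by induction the time
  is at most \<open>345 N - 126 k - 340\<close> for \<open>k\<close> edges and \<open>N\<close> matchings. The children have
  \<open>l + d l - L\<close> edges in total, where \<open>L\<close> counts the pairs of an edge at \<open>v\<close> and an edge avoiding \<open>v\<close>
  with a common endpoint. Each edge avoiding \<open>v\<close> meets at most two edges at \<open>v\<close>, so \<open>L \<le> 2 l\<close>,
  which suffices for \<open>d \<ge> 3\<close>. For \<open>d \<le> 2\<close> the choice of \<open>v\<close> bounds the degree of one neighbour by
  \<open>d\<close>, whence \<open>L \<le> l + 1\<close> for \<open>d = 2\<close> and \<open>L = 0\<close> for \<open>d = 1\<close>.

  Isolated vertices must not be touched at all, since a graph may have many of them and few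
  matchings. The edge array is therefore built by scanning the concatenated adjacency lists, in
  which only non-isolated vertices occur.\<close>

subsection \<open>Weakest preconditions\<close>

text \<open>Existence of an execution also certifies that no word or address bound is violated,
  because a violating program has none. The elapsed time is an argument of \<open>Q\<close>, so one
  predicate carries correctness and cost.\<close>

definition wp :: "nat \<Rightarrow> nat \<Rightarrow> com \<Rightarrow> (nat \<Rightarrow> state \<Rightarrow> bool) \<Rightarrow> state \<Rightarrow> bool" where
  "wp W S p Q s \<longleftrightarrow> (\<exists>t s'. exec W S p s t s' \<and> Q t s')"

lemma wp_Skip [simp]: "wp W S Skip Q s \<longleftrightarrow> Q 1 s"
  unfolding wp_def by (auto simp del: One_nat_def intro: exec.intros elim: exec.cases)

lemma wp_Add [simp]: "wp W S (Add x a b) Q s \<longleftrightarrow>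
    val s a + val s b < W \<and> Q 1 (set_reg x (val s a + val s b) s)"
  unfolding wp_def by (auto simp del: One_nat_def intro: exec.intros elim: exec.cases)

lemma wp_Sub [simp]: "wp W S (Sub x a b) Q s \<longleftrightarrow>
    val s a - val s b < W \<and> Q 1 (set_reg x (val s a - val s b) s)"
  unfolding wp_def by (auto simp del: One_nat_def intro: exec.intros elim: exec.cases)

lemma wp_Load [simp]: "wp W S (Load x a) Q s \<longleftrightarrow>
    val s a < S \<and> mem s (val s a) < W \<and> Q 1 (set_reg x (mem s (val s a)) s)"
  unfolding wp_def by (auto simp del: One_nat_def intro: exec.intros elim: exec.cases)

lemma wp_Store [simp]: "wp W S (Store a b) Q s \<longleftrightarrow>
    val s a < S \<and> val s b < W \<and> Q 1 (s\<lparr>mem := (mem s)(val s a := val s b)\<rparr>)"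
  unfolding wp_def by (auto simp del: One_nat_def intro: exec.intros elim: exec.cases)

lemma wp_Output [simp]: "wp W S (Output a) Q s \<longleftrightarrow>
    val s a < W \<and> Q 1 (s\<lparr>out := out s @ [val s a]\<rparr>)"
  unfolding wp_def by (auto simp del: One_nat_def intro: exec.intros elim: exec.cases)

lemma wp_Seq [simp]: "wp W S (Seq p q) Q s \<longleftrightarrow>
    wp W S p (\<lambda>t. wp W S q (\<lambda>t'. Q (t + t'))) s"
  unfolding wp_def by (blast intro: exec.Seq elim: SeqE)

lemma wp_IfElse [simp]: "wp W S (IfElse b p q) Q s \<longleftrightarrow>
    (if holds s b then wp W S p (\<lambda>t. Q (1 + t)) s else wp W S q (\<lambda>t. Q (1 + t)) s)"
  unfolding wp_def
  by (auto elim!: IfElseE) (metis IfTrue plus_1_eq_Suc, metis IfFalse plus_1_eq_Suc)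

lemma wp_mono: "wp W S p Q s \<Longrightarrow> (\<And>t s'. Q t s' \<Longrightarrow> Q' t s') \<Longrightarrow> wp W S p Q' s"
  unfolding wp_def by blast

text \<open>\<open>n\<close> counts the iterations still to come, so it serves both as induction
  variable and as time bound: each round costs at most \<open>c\<close> plus one test, and the
  failing test adds 1.\<close>

lemma wp_for:
  assumes step: "\<And>n s. I (Suc n) s \<Longrightarrow> holds s b \<and> wp W S p (\<lambda>t s'. t \<le> c \<and> I n s') s"
    and stop: "\<And>s. I 0 s \<Longrightarrow> \<not> holds s b"
    and init: "I n s"
  shows "wp W S (While b p) (\<lambda>t s'. t \<le> 1 + (c + 1) * n \<and> I 0 s') s"
  using init
proof (induction n arbitrary: s)
  case 0
  then show ?case
    using stop WhileFalse unfolding wp_def by fastforce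
next
  case (Suc n)
  from step[OF Suc.prems] obtain t s' where
    "holds s b" "exec W S p s t s'" "t \<le> c" "I n s'"
    unfolding wp_def by blast
  moreover from Suc.IH[OF \<open>I n s'\<close>] obtain t' s'' where
    "exec W S (While b p) s' t' s''" "t' \<le> 1 + (c + 1) * n" "I 0 s''"
    unfolding wp_def by blast
  ultimately show ?case
    unfolding wp_def
    by (intro exI[of _ "1 + t + t'"] exI[of _ s'']) (auto simp del: One_nat_def plus_1_eq_Suc intro!: WhileTrue)
qed

subsection \<open>In-place partition\<close>

text \<open>Pointers are kept in \<open>rA\<close> (edge array), \<open>rK\<close> (end of the current prefix), \<open>rBase\<close> and \<open>rSP\<close>
  (bottom and top of the stack). \<open>rMode\<close> is 0 on a call, 1 on a return and 2 at the end. Registers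
  0 and 1 are avoided because the simplifier rewrites \<open>1\<close> to \<open>Suc 0\<close>.\<close>

abbreviation (input) rA :: nat where "rA \<equiv> 2"
abbreviation (input) rBase :: nat where "rBase \<equiv> 3"
abbreviation (input) rSP :: nat where "rSP \<equiv> 4"
abbreviation (input) rMode :: nat where "rMode \<equiv> 5"
abbreviation (input) rK :: nat where "rK \<equiv> 6"
abbreviation (input) rQ :: nat where "rQ \<equiv> 7"
abbreviation (input) rJ :: nat where "rJ \<equiv> 8"
abbreviation (input) rU :: nat where "rU \<equiv> 9"
abbreviation (input) rV :: nat where "rV \<equiv> 10"
abbreviation (input) ra :: nat where "ra \<equiv> 11"
abbreviation (input) rb :: nat where "rb \<equiv> 12"
abbreviation (input) rc :: nat where "rc \<equiv> 13"
abbreviation (input) rd :: nat where "rd \<equiv> 14"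
abbreviation (input) rs :: nat where "rs \<equiv> 15"
abbreviation (input) rt :: nat where "rt \<equiv> 16"
abbreviation (input) rx :: nat where "rx \<equiv> 18"
abbreviation (input) ry :: nat where "ry \<equiv> 19"
abbreviation (input) rq :: nat where "rq \<equiv> 17"
abbreviation (input) rLo :: nat where "rLo \<equiv> 20"
abbreviation (input) rHi :: nat where "rHi \<equiv> 21"
abbreviation (input) rI :: nat where "rI \<equiv> 22"

abbreviation Seq_infix :: "com \<Rightarrow> com \<Rightarrow> com" (infixr ";;" 60) where
  "p ;; q \<equiv> Seq p q"

definition move :: "nat \<Rightarrow> operand \<Rightarrow> com" where
  "move x a = Add x a (Const 0)"

definition partition_body :: com where
  "partition_body =
     Load ra (Reg rJ) ;; Add rs (Reg rJ) (Const 1) ;; Load rb (Reg rs) ;;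
     IfElse (Equal (Reg ra) (Reg rU)) Skip
      (IfElse (Equal (Reg ra) (Reg rV)) Skip
        (IfElse (Equal (Reg rb) (Reg rU)) Skip
          (IfElse (Equal (Reg rb) (Reg rV)) Skip
            (Load rc (Reg rQ) ;; Add rt (Reg rQ) (Const 1) ;; Load rd (Reg rt) ;;
             Store (Reg rQ) (Reg ra) ;; Store (Reg rt) (Reg rb) ;;
             Store (Reg rJ) (Reg rc) ;; Store (Reg rs) (Reg rd) ;;
             Add rQ (Reg rQ) (Const 2))))) ;;
     Add rJ (Reg rJ) (Const 2)"

definition partition_prefix :: com where
  "partition_prefix =
     move rQ (Reg rA) ;; move rJ (Reg rA) ;; While (Less (Reg rJ) (Reg rK)) partition_body"

section \<open>Edge arrays in memory, two words per edge\<close>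

definition pairs_at :: "(nat \<Rightarrow> nat) \<Rightarrow> nat \<Rightarrow> (nat \<times> nat) list \<Rightarrow> bool" where
  "pairs_at m A xs \<longleftrightarrow>
     (\<forall>i<length xs. m (A + 2 * i) = fst (xs ! i) \<and> m (A + 2 * i + 1) = snd (xs ! i))"

definition avoids :: "nat \<Rightarrow> nat \<Rightarrow> nat \<times> nat \<Rightarrow> bool" where
  "avoids u v e \<longleftrightarrow> fst e \<noteq> u \<and> fst e \<noteq> v \<and> snd e \<noteq> u \<and> snd e \<noteq> v"

lemma pairs_at_update:
  assumes "pairs_at m A xs" "i < length xs" "p = A + 2 * i" "p' = A + 2 * i + 1"
  shows "pairs_at (m(p := a, p' := b)) A (xs[i := (a, b)])"
proof -
  \<comment> \<open>Parity separates first from second components, so the two writes can affect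
    entry \<open>i\<close> only.\<close>
  have "A + 2 * k \<noteq> A + 2 * i + 1" "A + 2 * k + 1 \<noteq> A + 2 * i" for k by presburger+
  then show ?thesis
    using assms unfolding pairs_at_def by (auto simp: nth_list_update)
qed

lemma pairs_at_cong:
  assumes "pairs_at m A xs" "\<And>a. A \<le> a \<Longrightarrow> a < A + 2 * length xs \<Longrightarrow> m' a = m a"
  shows "pairs_at m' A xs"
  using assms unfolding pairs_at_def by auto

lemma pairs_at_append:
  "pairs_at m A (xs @ ys) \<longleftrightarrow> pairs_at m A xs \<and> pairs_at m (A + 2 * length xs) ys"
proof -
  have "pairs_at m (A + 2 * length xs) ys" if *: "pairs_at m A (xs @ ys)"
    unfolding pairs_at_def
  proof (intro allI impI)
    fix i assume "i < length ys"
    with *[unfolded pairs_at_def, rule_format, of "length xs + i"]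
    show "m (A + 2 * length xs + 2 * i) = fst (ys ! i) \<and> m (A + 2 * length xs + 2 * i + 1) = snd (ys ! i)"
      by (simp add: nth_append algebra_simps)
  qed
  moreover have "pairs_at m A xs" if "pairs_at m A (xs @ ys)"
    using that unfolding pairs_at_def by (auto simp: nth_append)
  moreover have "pairs_at m A (xs @ ys)"
    if *: "pairs_at m A xs" "pairs_at m (A + 2 * length xs) ys"
    unfolding pairs_at_def
  proof (intro allI impI)
    fix i assume i: "i < length (xs @ ys)"
    show "m (A + 2 * i) = fst ((xs @ ys) ! i) \<and> m (A + 2 * i + 1) = snd ((xs @ ys) ! i)"
    proof (cases "i < length xs")
      case True
      then show ?thesis using *(1) by (auto simp: nth_append pairs_at_def)
    next
      case False
      define j where "j = i - length xs"
      have "i = length xs + j" "j < length ys" using False i by (auto simp: j_def)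
      then show ?thesis
        using *(2)[unfolded pairs_at_def, rule_format, of j] by (simp add: nth_append algebra_simps)
    qed
  qed
  ultimately show ?thesis by blast
qed

text \<open>Two-pointer scan started in \<open>s0\<close>: positions below \<open>q\<close> hold
  kept edges, those from \<open>q\<close> up to the scan position \<open>length xs - n\<close>
  rejected ones, and the last \<open>n\<close> are unexamined. Counting the unexamined entries fits
  \<open>wp_for\<close>.\<close>

definition partition_inv ::
    "nat \<Rightarrow> (nat \<times> nat) list \<Rightarrow> state \<Rightarrow> nat \<Rightarrow> state \<Rightarrow> bool" where
  "partition_inv A xs s0 n s \<longleftrightarrow> (\<exists>ys q. pairs_at (mem s) A ys \<and> mset ys = mset xs \<and>
     n \<le> length xs \<and> q \<le> length xs - n \<and>
     regs s rQ = A + 2 * q \<and> regs s rJ = A + 2 * (length xs - n) \<and>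
     (\<forall>i<q. avoids (regs s0 rU) (regs s0 rV) (ys ! i)) \<and>
     (\<forall>i. q \<le> i \<and> i < length xs - n \<longrightarrow> \<not> avoids (regs s0 rU) (regs s0 rV) (ys ! i)) \<and>
     (\<forall>r. r \<notin> {rQ, rJ, ra, rb, rc, rd, rs, rt} \<longrightarrow> regs s r = regs s0 r) \<and>
     (\<forall>a. \<not> (A \<le> a \<and> a < A + 2 * length xs) \<longrightarrow> mem s a = mem s0 a) \<and> out s = out s0)"

text \<open>A kept edge is swapped with entry \<open>q\<close>, the first rejected one, or stays in
  place if \<open>q\<close> is the scan position. The longest path takes 16 units.
  \<open>S + 4 \<le> W\<close> lets every address, even slightly incremented, fit into a
  word.\<close>

lemma partition_step:
  assumes inv: "partition_inv A xs s0 (Suc n) s"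
    and bnd: "A + 2 * length xs \<le> S" "S + 4 \<le> W" "\<forall>e \<in> set xs. fst e < W \<and> snd e < W"
    and K: "regs s0 rK = A + 2 * length xs"
  shows "holds s (Less (Reg rJ) (Reg rK)) \<and>
    wp W S partition_body (\<lambda>t s'. t \<le> 20 \<and> partition_inv A xs s0 n s') s"
proof -
  from inv obtain ys q where ys: "pairs_at (mem s) A ys" "mset ys = mset xs"
    and n: "Suc n \<le> length xs" "q \<le> length xs - Suc n"
    and r: "regs s rQ = A + 2 * q" "regs s rJ = A + 2 * (length xs - Suc n)"
    and ok: "\<And>i. i<q \<Longrightarrow> avoids (regs s0 rU) (regs s0 rV) (ys ! i)"
    and nok: "\<And>i. q \<le> i \<Longrightarrow> i < length xs - Suc n \<Longrightarrow> \<not> avoids (regs s0 rU) (regs s0 rV) (ys ! i)"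
    and fr: "\<And>r. r \<notin> {rQ, rJ, ra, rb, rc, rd, rs, rt} \<Longrightarrow> regs s r = regs s0 r"
    and fm: "\<And>a. \<not> (A \<le> a \<and> a < A + 2 * length xs) \<Longrightarrow> mem s a = mem s0 a"
    and o: "out s = out s0"
    unfolding partition_inv_def by blast
  define j where "j = length xs - Suc n"
  have len: "length ys = length xs" using ys(2) by (rule mset_eq_length)
  have j: "j < length xs" "q \<le> j" "length xs - n = Suc j" using n by (auto simp: j_def)
  have mj: "mem s (A + 2 * j) = fst (ys ! j)" "mem s (Suc (A + 2 * j)) = snd (ys ! j)"
    and mq: "mem s (A + 2 * q) = fst (ys ! q)" "mem s (Suc (A + 2 * q)) = snd (ys ! q)"
    using ys(1) j len unfolding pairs_at_def by auto
  have bb: "fst (ys ! i) < W \<and> snd (ys ! i) < W" if "i < length xs" for i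
  proof -
    have "ys ! i \<in> set xs" using that len ys(2) by (metis mset_eq_setD nth_mem)
    then show ?thesis using bnd(3) by blast
  qed
  note bq = bb[of q] and bj = bb[of j]
  have regs': "regs s rU = regs s0 rU" "regs s rV = regs s0 rV" "regs s rK = A + 2 * length xs"
    using fr K by auto
  have new: "avoids (regs s0 rU) (regs s0 rV) (ys ! j) \<Longrightarrow> i < Suc q \<Longrightarrow>
     avoids (regs s0 rU) (regs s0 rV) (ys[q := ys ! j, j := ys ! q] ! i)" for i
    using ok j len by (auto simp: nth_list_update less_Suc_eq)
  \<comment> \<open>After the swap, position \<open>j\<close> holds the former entry
    \<open>q\<close>, which had been rejected; for \<open>q = j\<close> the range is empty.\<close>
  have new': "avoids (regs s0 rU) (regs s0 rV) (ys ! j) \<Longrightarrow> Suc q \<le> i \<Longrightarrow> i < Suc j \<Longrightarrow>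
     \<not> avoids (regs s0 rU) (regs s0 rV) (ys[q := ys ! j, j := ys ! q] ! i)" for i
    using nok[of i] nok[of q] j len by (auto simp: nth_list_update less_Suc_eq j_def)
  have new2: "\<not> avoids (regs s0 rU) (regs s0 rV) (ys ! j) \<Longrightarrow> q \<le> i \<Longrightarrow> i < Suc j \<Longrightarrow>
     \<not> avoids (regs s0 rU) (regs s0 rV) (ys ! i)" for i
    using nok[of i] by (auto simp: less_Suc_eq j_def)
  have sw: "pairs_at ((mem s)(A + 2 * q := fst (ys ! j), Suc (A + 2 * q) := snd (ys ! j),
      A + 2 * j := fst (ys ! q), Suc (A + 2 * j) := snd (ys ! q))) A (ys[q := ys ! j, j := ys ! q])"
    (is "pairs_at ?m _ _")
  proof -
    have "pairs_at ((mem s)(A + 2 * q := fst (ys ! j), Suc (A + 2 * q) := snd (ys ! j))) A (ys[q := ys ! j])"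
      (is "pairs_at ?m' _ _")
      using pairs_at_update[OF ys(1), of q "A + 2 * q" "Suc (A + 2 * q)" "fst (ys ! j)" "snd (ys ! j)"]
        j len by simp
    from pairs_at_update[OF this, of j "A + 2 * j" "Suc (A + 2 * j)" "fst (ys ! q)" "snd (ys ! q)"]
    show ?thesis using j len by simp
  qed
  have msw: "mset (ys[q := ys ! j, j := ys ! q]) = mset xs"
    using mset_swap[of j ys q] j len ys(2) by (simp)
  note r' = r[folded j_def]
  show ?thesis
  proof (cases "avoids (regs s0 rU) (regs s0 rV) (ys ! j)")
    case True
    have fin: "partition_inv A xs s0 n s''"
      if "pairs_at (mem s'') A (ys[q := ys ! j, j := ys ! q])"
        "regs s'' rQ = A + 2 * Suc q" "regs s'' rJ = A + 2 * Suc j"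
        "\<And>r. r \<notin> {rQ, rJ, ra, rb, rc, rd, rs, rt} \<Longrightarrow> regs s'' r = regs s r"
        "\<And>a. a \<notin> {A + 2 * q, Suc (A + 2 * q), A + 2 * j, Suc (A + 2 * j)} \<Longrightarrow>
          mem s'' a = mem s a" "out s'' = out s" for s''
      unfolding partition_inv_def
    proof (intro exI[of _ "ys[q := ys ! j, j := ys ! q]"] exI[of _ "Suc q"] conjI)
      show "\<forall>i. Suc q \<le> i \<and> i < length xs - n \<longrightarrow>
          \<not> avoids (regs s0 rU) (regs s0 rV) (ys[q := ys ! j, j := ys ! q] ! i)"
        using new'[OF True] j(3) by simp
      note that' = that(5)
      have "mem s'' a = mem s0 a" if "\<not> (A \<le> a \<and> a < A + 2 * length xs)" for a
      proof -
        have "a \<notin> {A + 2 * q, Suc (A + 2 * q), A + 2 * j, Suc (A + 2 * j)}"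
          using \<open>\<not> (A \<le> a \<and> a < A + 2 * length xs)\<close> j by auto
        then show ?thesis using that'[of a] fm[of a] that by simp
      qed
      then show "\<forall>a. \<not> (A \<le> a \<and> a < A + 2 * length xs) \<longrightarrow> mem s'' a = mem s0 a" by blast
    qed (use that(1-4,6) msw new[OF True] j n(1) fr o in simp_all)
    from True show ?thesis
      using bq bj bnd j len
      apply (simp add: partition_body_def set_reg_def r' mj mq regs' avoids_def)
      apply (rule fin)
      using sw by simp_all
  next
    case False
    have fin: "partition_inv A xs s0 n s''"
      if "mem s'' = mem s" "regs s'' rQ = A + 2 * q" "regs s'' rJ = A + 2 * Suc j"
        "\<And>r. r \<notin> {rQ, rJ, ra, rb, rc, rd, rs, rt} \<Longrightarrow> regs s'' r = regs s r"
        "out s'' = out s" for s''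
      unfolding partition_inv_def
    proof (intro exI[of _ ys] exI[of _ q] conjI)
      show "\<forall>i. q \<le> i \<and> i < length xs - n \<longrightarrow> \<not> avoids (regs s0 rU) (regs s0 rV) (ys ! i)"
        using new2[OF False] j(3) by simp
      show "\<forall>a. \<not> (A \<le> a \<and> a < A + 2 * length xs) \<longrightarrow> mem s'' a = mem s0 a"
        using that(1) fm by simp
    qed (use that ys ok j n(1) fr o in simp_all)
    have eqs: "avoids (regs s0 rU) (regs s0 rV) (ys ! j) \<longleftrightarrow>
        regs s0 rU \<noteq> fst (ys ! j) \<and> regs s0 rV \<noteq> fst (ys ! j) \<and>
        regs s0 rU \<noteq> snd (ys ! j) \<and> regs s0 rV \<noteq> snd (ys ! j)"
      by (auto simp: avoids_def)
    show ?thesis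
      using bq bj bnd j len False
      apply (simp add: partition_body_def set_reg_def r' mj mq regs')
      by (intro conjI impI; (rule fin)?) (simp_all add: eqs r')
  qed
qed


text \<open>Only multisets are recorded, because the swaps do not keep the rejected edges in
  order.\<close>

definition partition_post :: "nat \<Rightarrow> (nat \<times> nat) list \<Rightarrow> state \<Rightarrow> state \<Rightarrow> bool" where
  "partition_post A xs s s' \<longleftrightarrow> (\<exists>zs ys. pairs_at (mem s') A (zs @ ys) \<and>
     mset zs = mset (filter (avoids (regs s rU) (regs s rV)) xs) \<and>
     mset ys = mset (filter (\<lambda>e. \<not> avoids (regs s rU) (regs s rV) e) xs) \<and>
     regs s' rQ = A + 2 * length zs \<and>
     (\<forall>r. r \<notin> {rQ, rJ, ra, rb, rc, rd, rs, rt} \<longrightarrow> regs s' r = regs s r) \<and>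
     (\<forall>a. \<not> (A \<le> a \<and> a < A + 2 * length xs) \<longrightarrow> mem s' a = mem s a) \<and> out s' = out s)"

text \<open>Each entry is charged 20 units and a loop test; the 3 extra units are the two moves and
  the failing test.\<close>

lemma wp_partition:
  assumes xs: "pairs_at (mem s) A xs" and K: "regs s rA = A" "regs s rK = A + 2 * length xs"
    and bnd: "A + 2 * length xs \<le> S" "S + 4 \<le> W" "\<forall>e \<in> set xs. fst e < W \<and> snd e < W"
  shows "wp W S partition_prefix (\<lambda>t s'. t \<le> 21 * length xs + 3 \<and> partition_post A xs s s') s"
proof -
  define s0 where "s0 = set_reg rJ A (set_reg rQ A s)"
  have s0: "mem s0 = mem s" "out s0 = out s" "regs s0 rK = A + 2 * length xs"
    "regs s0 rU = regs s rU" "regs s0 rV = regs s rV"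
    using K by (simp_all add: s0_def set_reg_def)
  have "wp W S (While (Less (Reg rJ) (Reg rK)) partition_body)
     (\<lambda>t s'. t \<le> 1 + (20 + 1) * length xs \<and> partition_inv A xs s0 0 s') s0"
  proof (rule wp_for)
    show "partition_inv A xs s0 (length xs) s0"
      using xs K unfolding partition_inv_def
      by (intro exI[of _ xs] exI[of _ 0]) (simp add: s0_def set_reg_def)
  next
    fix n s' assume "partition_inv A xs s0 (Suc n) s'"
    then show "holds s' (Less (Reg rJ) (Reg rK)) \<and>
      wp W S partition_body (\<lambda>t r. t \<le> 20 \<and> partition_inv A xs s0 n r) s'"
      using partition_step bnd s0 by blast
  next
    fix s' assume "partition_inv A xs s0 0 s'"
    then show "\<not> holds s' (Less (Reg rJ) (Reg rK))"
      using s0 unfolding partition_inv_def by force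
  qed
  then have "wp W S (While (Less (Reg rJ) (Reg rK)) partition_body)
     (\<lambda>t s'. t \<le> 21 * length xs + 1 \<and> partition_post A xs s s') s0"
  proof (rule wp_mono)
    fix t s' assume *: "t \<le> 1 + (20 + 1) * length xs \<and> partition_inv A xs s0 0 s'"
    then obtain ys q where ys: "pairs_at (mem s') A ys" "mset ys = mset xs"
      and q: "q \<le> length xs" "regs s' rQ = A + 2 * q"
      and ok: "\<forall>i<q. avoids (regs s rU) (regs s rV) (ys ! i)"
      and nok: "\<forall>i. q \<le> i \<and> i < length xs \<longrightarrow> \<not> avoids (regs s rU) (regs s rV) (ys ! i)"
      and fr: "\<forall>r. r \<notin> {rQ, rJ, ra, rb, rc, rd, rs, rt} \<longrightarrow> regs s' r = regs s0 r"
      and fm: "\<forall>a. \<not> (A \<le> a \<and> a < A + 2 * length xs) \<longrightarrow> mem s' a = mem s a" "out s' = out s"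
      unfolding partition_inv_def by (auto simp: s0)
    let ?P = "avoids (regs s rU) (regs s rV)"
    have len: "length ys = length xs" using ys(2) by (rule mset_eq_length)
    have ok': "\<forall>e\<in>set (take q ys). ?P e" and nok': "\<forall>e\<in>set (drop q ys). \<not> ?P e"
      using ok nok len q by (simp_all add: set_conv_nth) force+
    have 1: "filter ?P (take q ys) = take q ys" "filter (\<lambda>e. \<not> ?P e) (take q ys) = []"
      using ok' by (simp_all add: filter_id_conv filter_empty_conv)
    have 2: "filter ?P (drop q ys) = []" "filter (\<lambda>e. \<not> ?P e) (drop q ys) = drop q ys"
      using nok' by (simp_all add: filter_id_conv filter_empty_conv)
    have "filter ?P ys = take q ys" "filter (\<lambda>e. \<not> ?P e) ys = drop q ys"
      using 1 2 by (metis append_take_drop_id filter_append append_Nil2, metis append_take_drop_id filter_append append_Nil)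
    then have m: "mset (take q ys) = mset (filter ?P xs)" "mset (drop q ys) = mset (filter (\<lambda>e. \<not> ?P e) xs)"
      using ys(2) by (metis mset_filter)+
    have "\<forall>r. r \<notin> {rQ, rJ, ra, rb, rc, rd, rs, rt} \<longrightarrow> regs s' r = regs s r"
      using fr by (simp add: s0_def set_reg_def)
    then have "partition_post A xs s s'"
      unfolding partition_post_def using ys(1) m q len fm
      by (intro exI[of _ "take q ys"] exI[of _ "drop q ys"]) auto
    then show "t \<le> 21 * length xs + 1 \<and> partition_post A xs s s'"
      using * by simp
  qed
  then show ?thesis
    unfolding partition_prefix_def move_def using K bnd
    by (simp add: s0_def set_reg_def)
qed

subsection \<open>Matchings and branching\<close>

definition edge :: "nat \<times> nat \<Rightarrow> nat set" where
  "edge e = {fst e, snd e}"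

definition edges :: "(nat \<times> nat) list \<Rightarrow> nat set set" where
  "edges xs = edge ` set xs"

text \<open>Distinctness is required of the edges as sets, which also rules out an edge stored in
  both orientations.\<close>

definition proper :: "(nat \<times> nat) list \<Rightarrow> bool" where
  "proper xs \<longleftrightarrow> distinct (map edge xs) \<and> (\<forall>e \<in> set xs. fst e \<noteq> snd e)"

abbreviation disjoint_edges :: "nat \<times> nat \<Rightarrow> nat \<times> nat \<Rightarrow> bool" where
  "disjoint_edges e \<equiv> avoids (fst e) (snd e)"

text \<open>\<open>reports\<close> does not expose the edge set left at the end. Quantifying over
  all continuations from \<open>M'\<close> does, and makes command sequences compose.\<close>

definition transforms :: "nat set set \<Rightarrow> nat list \<Rightarrow> nat set set list \<Rightarrow> nat set set \<Rightarrow> bool" where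
  "transforms M ws Ms M' \<longleftrightarrow>
     (\<forall>ws' Ms'. reports M' ws' Ms' \<longrightarrow> reports M (ws @ ws') (Ms @ Ms'))"

lemma transforms_Nil: "transforms M [] [] M"
  by (simp add: transforms_def)

lemma transforms_append:
  "transforms M ws Ms M' \<Longrightarrow> transforms M' vs Ns M'' \<Longrightarrow> transforms M (ws @ vs) (Ms @ Ns) M''"
  by (simp add: transforms_def)

lemma transforms_report: "transforms M [0] [M] M"
  by (simp add: transforms_def reports.report)

lemma transforms_insert: "transforms M [1, u, v] [] (insert {u, v} M)"
  using reports.insert by (simp add: transforms_def)

lemma transforms_remove: "transforms M [2, u, v] [] (M - {{u, v}})"
  using reports.remove by (simp add: transforms_def)

lemma transforms_reports: "transforms M ws Ms M' \<Longrightarrow> reports M ws Ms"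
  unfolding transforms_def using reports.finish[of M'] by fastforce

section \<open>Edge sets of arrays and the decomposition of matchings at a vertex\<close>

lemma avoids_edge: "avoids u v e \<longleftrightarrow> {u, v} \<inter> edge e = {}"
  by (auto simp: avoids_def edge_def)

lemma edges_filter: "edges (filter (avoids u v) zs) = {g \<in> edges zs. {u, v} \<inter> g = {}}"
  by (auto simp: edges_def avoids_edge)

lemma edges_mset: "mset xs = mset ys \<Longrightarrow> edges xs = edges ys"
  unfolding edges_def by (metis set_mset_mset)

lemma proper_mset: "mset xs = mset ys \<Longrightarrow> proper xs \<longleftrightarrow> proper ys"
  unfolding proper_def by (metis mset_eq_imp_distinct_iff mset_eq_setD mset_map)

lemma proper_filter: "proper xs \<Longrightarrow> proper (filter P xs)"
  by (simp add: proper_def distinct_map_filter)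

text \<open>The edges of \<open>H\<close> share \<open>v\<close>, so a matching contains at most one
  of them; if it contains \<open>e\<close>, the remaining edges lie in \<open>G\<close> and are
  disjoint from \<open>e\<close>.\<close>

lemma matching_split:
  assumes H: "\<forall>e\<in>H. v \<in> e" and G: "\<forall>g\<in>G. v \<notin> g"
  shows "{N. matching (G \<union> H) N} =
    {N. matching G N} \<union> (\<Union>e\<in>H. insert e ` {N. matching {g \<in> G. e \<inter> g = {}} N})" (is "?L = ?R")
proof
  show "?L \<subseteq> ?R"
  proof
    fix N assume "N \<in> ?L"
    then have sub: "N \<subseteq> G \<union> H" and dis: "\<forall>e\<in>N. \<forall>f\<in>N. e \<noteq> f \<longrightarrow> e \<inter> f = {}"
      by (auto simp: matching_def)
    show "N \<in> ?R"
    proof (cases "N \<inter> H = {}")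
      case True
      then show ?thesis using sub dis by (auto simp: matching_def)
    next
      case False
      then obtain e where e: "e \<in> N" "e \<in> H" by blast
      have "f \<notin> H" if "f \<in> N - {e}" for f
        using that dis e H by blast
      then have "matching {g \<in> G. e \<inter> g = {}} (N - {e})"
        using sub dis e unfolding matching_def by blast
      moreover have "N = insert e (N - {e})" using e by blast
      ultimately show ?thesis using e(2) by blast
    qed
  qed
  show "?R \<subseteq> ?L"
    unfolding matching_def by blast
qed

text \<open>The matchings that contain \<open>e\<close> and take all their other edges from
  \<open>zs\<close>.\<close>

definition branch :: "(nat \<times> nat) list \<Rightarrow> nat \<times> nat \<Rightarrow> nat set set set" where
  "branch zs e = insert (edge e) ` {N. matching (edges (filter (disjoint_edges e) zs)) N}"

lemma branch_mset: "mset zs = mset zs' \<Longrightarrow> branch zs e = branch zs' e"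
  unfolding branch_def by (metis edges_mset mset_filter)

lemma matching_branch:
  assumes ys: "\<forall>e\<in>set ys. v \<in> edge e" and zs: "\<forall>e\<in>set zs. v \<notin> edge e"
    and xs: "mset xs = mset zs + mset ys"
  shows "{N. matching (edges xs) N} = {N. matching (edges zs) N} \<union> (\<Union>e\<in>set ys. branch zs e)"
proof -
  have "edges xs = edges zs \<union> edges ys"
    using edges_mset[of xs "zs @ ys"] xs by (auto simp: edges_def)
  moreover have "{g \<in> edges zs. edge e \<inter> g = {}} = edges (filter (disjoint_edges e) zs)" for e
    by (simp add: edges_filter) (simp add: edge_def)
  ultimately show ?thesis
    using matching_split[of "edges ys" v "edges zs"] ys zs
    by (simp add: edges_def branch_def image_image)
qed

lemma branch_member:
  assumes "N \<in> branch zs e"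
  shows "edge e \<in> N" "N \<subseteq> insert (edge e) (edges zs)"
  using assms by (auto simp: branch_def matching_def edges_def)

lemma inj_on_insert_branch:
  assumes "edge e \<notin> edges zs"
  shows "inj_on (insert (edge e)) {N. matching (edges (filter (disjoint_edges e) zs)) N}"
proof (rule inj_onI)
  fix N N' assume *: "N \<in> {N. matching (edges (filter (disjoint_edges e) zs)) N}"
    "N' \<in> {N. matching (edges (filter (disjoint_edges e) zs)) N}"
    "insert (edge e) N = insert (edge e) N'"
  then have "edge e \<notin> N" "edge e \<notin> N'"
    using assms by (auto simp: matching_def edges_def)
  then show "N = N'" using *(3) by (metis insert_ident)
qed

section \<open>Counting the edges lost in the branches\<close>

definition loss :: "(nat \<times> nat) list \<Rightarrow> nat \<times> nat \<Rightarrow> nat" where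
  "loss zs e = length (filter (\<lambda>z. \<not> disjoint_edges e z) zs)"

lemma loss_eq: "loss zs e + length (filter (disjoint_edges e) zs) = length zs"
  unfolding loss_def using sum_length_filter_compl[of "disjoint_edges e" zs] by simp

lemma loss_mset: "mset zs = mset zs' \<Longrightarrow> loss zs e = loss zs' e"
  unfolding loss_def by (metis mset_filter size_mset)

text \<open>Double counting, by the edges \<open>z\<close> of \<open>zs\<close>: since
  \<open>z\<close> avoids \<open>v\<close>, an edge at \<open>v\<close> meeting \<open>z\<close>
  must join \<open>v\<close> to one of the two endpoints of \<open>z\<close>.\<close>

lemma sum_loss_le:
  assumes ys: "\<forall>e\<in>set ys. v \<in> edge e" "distinct (map edge ys)" and zs: "\<forall>e\<in>set zs. v \<notin> edge e"
  shows "sum_list (map (loss zs) ys) \<le> 2 * length zs"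
  using zs
proof (induction zs)
  case Nil
  then show ?case by (simp add: loss_def)
next
  case (Cons z zs)
  let ?T = "filter (\<lambda>e. \<not> disjoint_edges e z) ys"
  have "edge ` set ?T \<subseteq> {{v, fst z}, {v, snd z}}"
  proof
    fix f assume "f \<in> edge ` set ?T"
    then obtain e where e: "f = edge e" "e \<in> set ys" "\<not> disjoint_edges e z" by auto
    then show "f \<in> {{v, fst z}, {v, snd z}}"
      using ys(1) Cons.prems by (auto simp: avoids_def edge_def)
  qed
  then have "card (edge ` set ?T) \<le> card {{v, fst z}, {v, snd z}}"
    by (intro card_mono) auto
  also have "\<dots> \<le> 2"
    by (simp add: card_insert_if)
  finally have "card (set (map edge ?T)) \<le> 2" by simp
  moreover have "distinct (map edge ?T)"
    using ys(2) by (rule distinct_map_filter)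
  ultimately have "length ?T \<le> 2"
    by (metis distinct_card length_map)
  \<comment> \<open>The order of counting is exchanged here: adding \<open>z\<close> raises the
    total loss by the number of edges of \<open>us\<close> meeting \<open>z\<close>.\<close>
  moreover have "sum_list (map (loss (z # zs)) us) =
      length (filter (\<lambda>e. \<not> disjoint_edges e z) us) + sum_list (map (loss zs) us)" for us
    by (induction us) (auto simp: loss_def)
  ultimately show ?case
    using Cons by simp
qed

text \<open>An edge of \<open>zs\<close> avoids \<open>v\<close>, so it meets \<open>e0\<close> only
  at \<open>w\<close>. The degree of \<open>w\<close> is at most that of \<open>v\<close>, which is
  \<open>length ys\<close>, and \<open>e0\<close> itself uses one of these places; hence
  \<open>e0\<close> loses at most \<open>length ys - 1\<close> edges. For two edges at
  \<open>v\<close>, the other one loses at most all of \<open>zs\<close>.\<close>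

lemma sum_loss_cases:
  assumes zs: "mset zs = mset (filter (avoids v v) xs)"
    and ys: "mset ys = mset (filter (\<lambda>e. \<not> avoids v v e) xs)"
    and e0: "e0 \<in> set xs" "edge e0 = {v, w}" and xs: "proper xs"
    and deg: "length (filter (avoids v v) xs) \<le> length (filter (avoids w w) xs)"
  shows "ys \<noteq> []" "sum_list (map (loss zs) ys) \<le> 2 * length zs"
    "length ys = 2 \<Longrightarrow> sum_list (map (loss zs) ys) \<le> length zs + 1"
    "length ys = 1 \<Longrightarrow> sum_list (map (loss zs) ys) = 0"
proof -
  have sy: "set ys = set (filter (\<lambda>e. \<not> avoids v v e) xs)" and sz: "set zs = set (filter (avoids v v) xs)"
    using zs ys by (metis set_mset_mset)+
  have e0y: "e0 \<in> set ys"
    using e0 sy by (auto simp: avoids_edge)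
  then show "ys \<noteq> []" by auto
  have vz: "\<forall>e\<in>set zs. v \<notin> edge e" and vy: "\<forall>e\<in>set ys. v \<in> edge e"
    using sz sy by (auto simp: avoids_edge)
  have "proper ys"
    using proper_filter[OF xs] proper_mset[OF ys] by blast
  then show "sum_list (map (loss zs) ys) \<le> 2 * length zs"
    using sum_loss_le[OF vy _ vz] by (simp add: proper_def)
  have split: "mset xs = mset zs + mset ys"
    unfolding zs ys mset_filter by (rule multiset_partition)
  have len: "length zs = length (filter (avoids v v) xs)" "length xs = length zs + length ys"
    using zs split by (metis size_mset, metis size_mset size_union)
  have "loss zs e0 = length (filter (\<lambda>z. \<not> avoids w w z) zs)"
  proof -
    have "disjoint_edges e0 z \<longleftrightarrow> avoids w w z" if "z \<in> set zs" for z
      using vz that e0(2) by (auto simp: avoids_edge edge_def)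
    then have "filter (\<lambda>z. \<not> disjoint_edges e0 z) zs = filter (\<lambda>z. \<not> avoids w w z) zs"
      by (intro filter_cong) auto
    then show ?thesis by (simp add: loss_def)
  qed
  \<comment> \<open>\<open>e0\<close> is an edge at \<open>w\<close> inside \<open>ys\<close>; it
    accounts for the 1 gained below.\<close>
  moreover have "length (filter (\<lambda>z. \<not> avoids w w z) ys) \<ge> 1"
  proof -
    have "e0 \<in> set (filter (\<lambda>z. \<not> avoids w w z) ys)"
      using e0y e0(2) by (auto simp: avoids_edge)
    from length_pos_if_in_set[OF this] show ?thesis by linarith
  qed
  moreover have "length (filter (\<lambda>z. \<not> avoids w w z) xs) =
      length (filter (\<lambda>z. \<not> avoids w w z) zs) + length (filter (\<lambda>z. \<not> avoids w w z) ys)"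
  proof -
    have "size (filter_mset (\<lambda>z. \<not> avoids w w z) (mset xs)) =
        size (filter_mset (\<lambda>z. \<not> avoids w w z) (mset zs)) + size (filter_mset (\<lambda>z. \<not> avoids w w z) (mset ys))"
      by (simp add: split)
    then show ?thesis by (simp flip: mset_filter)
  qed
  moreover have "length (filter (\<lambda>z. \<not> avoids w w z) xs) + length (filter (avoids w w) xs) = length xs"
    using sum_length_filter_compl[of "avoids w w" xs] by simp
  ultimately have e0l: "loss zs e0 + 1 \<le> length ys"
    using deg len by linarith
  have le: "loss zs e \<le> length zs" for e
    unfolding loss_def by simp
  show "sum_list (map (loss zs) ys) = 0" if one: "length ys = 1"
  proof -
    obtain f where f: "ys = [f]" using one by (auto simp: length_Suc_conv)
    then have "e0 = f" using e0y by simp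
    then show ?thesis using e0l f by simp
  qed
  show "sum_list (map (loss zs) ys) \<le> length zs + 1" if two: "length ys = 2"
  proof -
    obtain f g where fg: "ys = [f, g]" using two
      by (auto simp: numeral_2_eq_2 length_Suc_conv)
    have "e0 = f \<or> e0 = g" using e0y fg by simp
    then have "loss zs f \<le> 1 \<or> loss zs g \<le> 1" using e0l unfolding two by fastforce
    then show ?thesis using le[of f] le[of g] by (simp add: fg) linarith
  qed
qed

subsection \<open>Branching on a vertex\<close>

text \<open>With both pivots equal, the partition by an edge becomes a partition by incidence with
  one vertex.\<close>

definition isolate :: "operand \<Rightarrow> com" where
  "isolate u = move rU u ;; move rV u ;; partition_prefix"

text \<open>Isolating a vertex keeps the edges avoiding it, so fewer kept edges means larger degree.\<close>

definition choose_vertex :: com where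
  "choose_vertex =
     isolate (Reg rx) ;; move rq (Reg rQ) ;; isolate (Reg ry) ;;
     IfElse (Less (Reg rq) (Reg rQ)) (isolate (Reg rx)) Skip"

text \<open>A stack frame consists of three pointers: the end of the edges avoiding the chosen vertex, the
  end of the edges at that vertex, and the next one of the latter to be tried.\<close>

definition call_step :: com where
  "call_step =
     IfElse (Equal (Reg rK) (Reg rA))
       (Output (Const 0) ;; move rMode (Const 1))
       (Load rx (Reg rA) ;; Add rs (Reg rA) (Const 1) ;; Load ry (Reg rs) ;;
        choose_vertex ;;
        Store (Reg rSP) (Reg rQ) ;; Add rSP (Reg rSP) (Const 1) ;;
        Store (Reg rSP) (Reg rK) ;; Add rSP (Reg rSP) (Const 1) ;;
        Store (Reg rSP) (Reg rQ) ;; Add rSP (Reg rSP) (Const 1) ;;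
        move rK (Reg rQ))"

text \<open>Every edge avoiding the chosen vertex \<open>v\<close> is disjoint from the edge \<open>{u, v}\<close> iff it avoids \<open>u\<close>, so
  partitioning by both endpoints makes it unnecessary to remember which of them is \<open>v\<close>.\<close>

definition return_step :: com where
  "return_step =
     IfElse (Equal (Reg rSP) (Reg rBase))
       (move rMode (Const 2))
       (Sub rs (Reg rSP) (Const 3) ;; Load rLo (Reg rs) ;;
        Sub rs (Reg rSP) (Const 2) ;; Load rHi (Reg rs) ;;
        Sub rs (Reg rSP) (Const 1) ;; Load rI (Reg rs) ;;
        IfElse (Less (Reg rLo) (Reg rI))
          (Sub rs (Reg rI) (Const 2) ;; Load ra (Reg rs) ;;
           Sub rs (Reg rI) (Const 1) ;; Load rb (Reg rs) ;;
           Output (Const 2) ;; Output (Reg ra) ;; Output (Reg rb))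
          Skip ;;
        IfElse (Equal (Reg rI) (Reg rHi))
          (Sub rSP (Reg rSP) (Const 3))
          (Load rU (Reg rI) ;; Add rs (Reg rI) (Const 1) ;; Load rV (Reg rs) ;;
           Output (Const 1) ;; Output (Reg rU) ;; Output (Reg rV) ;;
           Add rI (Reg rI) (Const 2) ;; Sub rs (Reg rSP) (Const 1) ;; Store (Reg rs) (Reg rI) ;;
           move rK (Reg rLo) ;; partition_prefix ;;
           move rK (Reg rQ) ;; move rMode (Const 0)))"

definition main_body :: com where
  "main_body = IfElse (Equal (Reg rMode) (Const 0)) call_step return_step"

definition main_loop :: com where
  "main_loop = While (Less (Reg rMode) (Const 2)) main_body"

text \<open>Registers from 7 to \<open>h\<close> are scratch registers.\<close>

definition preserves :: "nat \<Rightarrow> nat \<Rightarrow> nat \<Rightarrow> state \<Rightarrow> state \<Rightarrow> bool" where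
  "preserves h A n s s' \<longleftrightarrow> (\<forall>r. r < 7 \<or> h < r \<longrightarrow> regs s' r = regs s r) \<and>
     (\<forall>a. \<not> (A \<le> a \<and> a < A + 2 * n) \<longrightarrow> mem s' a = mem s a) \<and> out s' = out s"

lemma preserves_trans: "preserves h A n s s' \<Longrightarrow> preserves h A n s' s'' \<Longrightarrow> preserves h A n s s''"
  by (simp add: preserves_def)

text \<open>The register bound \<open>h\<close> is 16 after a single partition and 17 once
  \<open>rq\<close> has been overwritten as well.\<close>

definition splits :: "nat \<Rightarrow> nat \<Rightarrow> nat \<Rightarrow> nat \<Rightarrow> (nat \<times> nat) list \<Rightarrow> state \<Rightarrow> state \<Rightarrow> bool" where
  "splits h A u v xs s s' \<longleftrightarrow> preserves h A (length xs) s s' \<and>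
     (\<exists>zs ys. pairs_at (mem s') A (zs @ ys) \<and> mset zs = mset (filter (avoids u v) xs) \<and>
       mset ys = mset (filter (\<lambda>e. \<not> avoids u v e) xs) \<and> regs s' rQ = A + 2 * length zs)"

lemma wp_partition_splits:
  assumes "pairs_at (mem s) A xs" "regs s rA = A" "regs s rK = A + 2 * length xs"
    and "A + 2 * length xs \<le> S" "S + 4 \<le> W" "\<forall>e \<in> set xs. fst e < W \<and> snd e < W"
  shows "wp W S partition_prefix
    (\<lambda>t s'. t \<le> 21 * length xs + 3 \<and> splits 16 A (regs s rU) (regs s rV) xs s s') s"
  by (rule wp_mono[OF wp_partition[OF assms]])
    (auto simp: partition_post_def splits_def preserves_def)

lemma wp_isolate:
  assumes "pairs_at (mem s) A xs" "regs s rA = A" "regs s rK = A + 2 * length xs"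
    and "A + 2 * length xs \<le> S" "S + 4 \<le> W" "\<forall>e \<in> set xs. fst e < W \<and> snd e < W"
    and u: "u = Reg x" "16 < x" "regs s x < W"
  shows "wp W S (isolate u)
    (\<lambda>t s'. t \<le> 21 * length xs + 5 \<and> splits 16 A (regs s x) (regs s x) xs s s') s"
proof -
  have "regs s x + 0 < W" using u by simp
  then show ?thesis
    unfolding isolate_def move_def using u
    apply (simp add: set_reg_def)
    apply (rule wp_mono[OF wp_partition_splits[where xs = xs]])
    using assms(1-6) by (auto simp: splits_def preserves_def)
qed

lemma preserves_mono: "preserves h A n s s' \<Longrightarrow> h \<le> h' \<Longrightarrow> preserves h' A n s s'"
  by (simp add: preserves_def)

lemma splits_perm:
  assumes "splits h A u v xs s s'" "mset xs = mset xs'"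
  shows "splits h A u v xs' s s'"
  using assms mset_eq_length[of xs xs'] unfolding splits_def by (simp add: mset_filter)

lemma splits_pairs:
  assumes "splits h A u v xs s s'"
  obtains xs' where "pairs_at (mem s') A xs'" "mset xs' = mset xs"
proof -
  from assms obtain zs ys where "pairs_at (mem s') A (zs @ ys)" "mset zs = mset (filter (avoids u v) xs)"
       "mset ys = mset (filter (\<lambda>e. \<not> avoids u v e) xs)" unfolding splits_def by blast
  then show ?thesis using that[of "zs @ ys"] by (simp flip: multiset_partition)
qed

lemma splits_Q: "splits h A u v xs s s' \<Longrightarrow> regs s' rQ = A + 2 * length (filter (avoids u v) xs)"
  unfolding splits_def by (metis size_mset)

text \<open>The array is split by one endpoint, then by the other. If the first split kept fewer
  edges it is repeated; otherwise the second is already the right one. At most three partitions give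
  the factor 63.\<close>

lemma wp_choose_vertex:
  assumes xs: "pairs_at (mem s) A xs" "regs s rA = A" "regs s rK = A + 2 * length xs"
    and bnd: "A + 2 * length xs \<le> S" "S + 4 \<le> W" "\<forall>e \<in> set xs. fst e < W \<and> snd e < W"
    and xy: "regs s rx < W" "regs s ry < W"
  shows "wp W S choose_vertex
    (\<lambda>t s'. t \<le> 63 * length xs + 20 \<and>
      (\<exists>v w. {v, w} = {regs s rx, regs s ry} \<and>
        length (filter (avoids v v) xs) \<le> length (filter (avoids w w) xs) \<and> splits 17 A v v xs s s')) s"
proof -
  let ?x = "regs s rx" and ?y = "regs s ry"
  have set_xs: "\<forall>e \<in> set xs'. fst e < W \<and> snd e < W" if "mset xs' = mset xs" for xs'
    using that bnd(3) by (metis set_mset_mset)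
  show ?thesis
    unfolding choose_vertex_def wp_Seq
  proof (rule wp_mono[OF wp_isolate[OF xs bnd refl]]; (use xy in simp)?)
    fix t1 s1 assume 1: "t1 \<le> 21 * length xs + 5 \<and> splits 16 A ?x ?x xs s s1"
    then obtain xs1 where xs1: "pairs_at (mem s1) A xs1" "mset xs1 = mset xs"
      using splits_pairs by blast
    have len1: "length xs1 = length xs" using xs1(2) by (rule mset_eq_length)
    have p1: "preserves 16 A (length xs) s s1" and q1: "regs s1 rQ = A + 2 * length (filter (avoids ?x ?x) xs)"
      using 1 splits_Q unfolding splits_def by blast+
    \<comment> \<open>\<open>rq\<close> lies outside the registers used by a partition, so the first
      count survives the second split.\<close>
    define s1' where "s1' = set_reg rq (regs s1 rQ) s1"
    have r1: "mem s1' = mem s1" "regs s1' rA = A" "regs s1' rK = A + 2 * length xs1"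
       "regs s1' rx = ?x" "regs s1' ry = ?y" "regs s1' rq = A + 2 * length (filter (avoids ?x ?x) xs)"
       and ps1: "preserves 17 A (length xs) s s1'"
      using p1 xs q1 len1 by (simp_all add: s1'_def set_reg_def preserves_def)
    have "regs s1 rQ + 0 < W"
      using q1 bnd length_filter_le[of "avoids ?x ?x" xs] by linarith
    moreover have "wp W S (isolate (Reg ry)) (\<lambda>t2. wp W S (IfElse (Less (Reg rq) (Reg rQ)) (isolate (Reg rx)) Skip)
       (\<lambda>t3 s'. t1 + (1 + (t2 + t3)) \<le> 63 * length xs + 20 \<and>
      (\<exists>v w. {v, w} = {?x, ?y} \<and> length (filter (avoids v v) xs) \<le> length (filter (avoids w w) xs) \<and>
        splits 17 A v v xs s s'))) s1'"
    proof (rule wp_mono[OF wp_isolate[of s1' A xs1 S W "Reg ry" ry]])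
      show "pairs_at (mem s1') A xs1" using xs1 r1 by simp
      show "A + 2 * length xs1 \<le> S" using len1 bnd by simp
      show "\<forall>e\<in>set xs1. fst e < W \<and> snd e < W" using set_xs xs1 by blast
      fix t2 s2 assume 2: "t2 \<le> 21 * length xs1 + 5 \<and> splits 16 A (regs s1' ry) (regs s1' ry) xs1 s1' s2"
      then have sp: "splits 16 A ?y ?y xs s1' s2"
        using splits_perm[OF _ xs1(2)] r1 by simp
      then obtain xs2 where xs2: "pairs_at (mem s2) A xs2" "mset xs2 = mset xs"
        using splits_pairs by blast
      have len2: "length xs2 = length xs" using xs2(2) by (rule mset_eq_length)
      have p2: "preserves 16 A (length xs) s1' s2" and q2: "regs s2 rQ = A + 2 * length (filter (avoids ?y ?y) xs)"
        using sp splits_Q unfolding splits_def by blast+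
      have ps2: "preserves 17 A (length xs) s s2"
        using preserves_trans[OF ps1 preserves_mono[OF p2]] by simp
      have r2: "regs s2 rA = A" "regs s2 rK = A + 2 * length xs2" "regs s2 rx = ?x"
        using ps2 xs len2 by (simp_all add: preserves_def)
      have rq2: "regs s2 rq = A + 2 * length (filter (avoids ?x ?x) xs)"
        using p2 r1 by (simp add: preserves_def)
      show "wp W S (IfElse (Less (Reg rq) (Reg rQ)) (isolate (Reg rx)) Skip)
       (\<lambda>t3 s'. t1 + (1 + (t2 + t3)) \<le> 63 * length xs + 20 \<and>
      (\<exists>v w. {v, w} = {?x, ?y} \<and> length (filter (avoids v v) xs) \<le> length (filter (avoids w w) xs) \<and>
        splits 17 A v v xs s s')) s2"
      proof (cases "regs s2 rq < regs s2 rQ")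
        case True
        have "wp W S (isolate (Reg rx)) (\<lambda>t3 s'. t1 + (1 + (t2 + (1 + t3))) \<le> 63 * length xs + 20 \<and>
      (\<exists>v w. {v, w} = {?x, ?y} \<and> length (filter (avoids v v) xs) \<le> length (filter (avoids w w) xs) \<and>
        splits 17 A v v xs s s')) s2"
        proof (rule wp_mono[OF wp_isolate[of s2 A xs2 S W "Reg rx" rx]])
          show "pairs_at (mem s2) A xs2" using xs2 by simp
          show "A + 2 * length xs2 \<le> S" using len2 bnd by simp
          show "\<forall>e\<in>set xs2. fst e < W \<and> snd e < W" using set_xs xs2 by blast
          fix t3 s3 assume 3: "t3 \<le> 21 * length xs2 + 5 \<and> splits 16 A (regs s2 rx) (regs s2 rx) xs2 s2 s3"
          then have "splits 16 A ?x ?x xs s2 s3"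
            using splits_perm[OF _ xs2(2)] r2 by simp
          then have "splits 17 A ?x ?x xs s s3"
            using preserves_trans[OF ps2 preserves_mono[of 16]] unfolding splits_def by auto
          then show "t1 + (1 + (t2 + (1 + t3))) \<le> 63 * length xs + 20 \<and>
      (\<exists>v w. {v, w} = {?x, ?y} \<and> length (filter (avoids v v) xs) \<le> length (filter (avoids w w) xs) \<and>
        splits 17 A v v xs s s3)"
            using 1 2 3 len1 len2 True rq2 q2 by (intro conjI exI[of _ ?x] exI[of _ ?y]) auto
        qed (use r2 bnd xy in auto)
        then show ?thesis using True by simp
      next
        case False
        have "splits 17 A ?y ?y xs s s2"
          using sp ps2 unfolding splits_def by blast
        then have "t1 + (1 + (t2 + (1 + 1))) \<le> 63 * length xs + 20 \<and>
      (\<exists>v w. {v, w} = {?x, ?y} \<and> length (filter (avoids v v) xs) \<le> length (filter (avoids w w) xs) \<and>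
        splits 17 A v v xs s s2)"
          using 1 2 len1 len2 False rq2 q2 by (intro conjI exI[of _ ?y] exI[of _ ?x]) auto
        then show ?thesis using False by simp
      qed
    qed (use r1 bnd xy in auto)
    ultimately show "wp W S (move rq (Reg rQ)) (\<lambda>t. wp W S (isolate (Reg ry)) (\<lambda>t2.
        wp W S (IfElse (Less (Reg rq) (Reg rQ)) (isolate (Reg rx)) Skip)
       (\<lambda>t3 s'. t1 + (t + (t2 + t3)) \<le> 63 * length xs + 20 \<and>
      (\<exists>v w. {v, w} = {?x, ?y} \<and> length (filter (avoids v v) xs) \<le> length (filter (avoids w w) xs) \<and>
        splits 17 A v v xs s s')))) s1"
      unfolding move_def by (simp add: s1'_def del: wp_IfElse)
  qed
qed

section \<open>Opening a node: choosing a vertex and pushing a frame\<close>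

definition opened :: "nat \<Rightarrow> (nat \<times> nat) list \<Rightarrow> state \<Rightarrow> state \<Rightarrow> bool" where
  "opened A xs s s' \<longleftrightarrow> (\<exists>zs ys v w. pairs_at (mem s') A (zs @ ys) \<and>
     mset zs = mset (filter (avoids v v) xs) \<and> mset ys = mset (filter (\<lambda>e. \<not> avoids v v e) xs) \<and>
     edge (xs ! 0) = {v, w} \<and> length (filter (avoids v v) xs) \<le> length (filter (avoids w w) xs) \<and>
     regs s' rK = A + 2 * length zs \<and> regs s' rSP = regs s rSP + 3 \<and>
     mem s' (regs s rSP) = A + 2 * length zs \<and> mem s' (regs s rSP + 1) = A + 2 * length xs \<and>
     mem s' (regs s rSP + 2) = A + 2 * length zs) \<and>
   (\<forall>r\<in>{rA, rBase, rMode}. regs s' r = regs s r) \<and>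
   (\<forall>a < regs s rSP. \<not> (A \<le> a \<and> a < A + 2 * length xs) \<longrightarrow> mem s' a = mem s a) \<and> out s' = out s"

text \<open>The stack top lies beyond the edge prefix, so pushing the three pointers leaves the
  freshly split array intact.\<close>

lemma wp_call_step:
  assumes xs: "pairs_at (mem s) A xs" "regs s rA = A" "regs s rK = A + 2 * length xs" "xs \<noteq> []"
    and bnd: "S + 4 \<le> W" "\<forall>e \<in> set xs. fst e < W \<and> snd e < W"
    and SP: "A + 2 * length xs \<le> regs s rSP" "regs s rSP + 3 \<le> S"
  shows "wp W S call_step (\<lambda>t s'. t \<le> 63 * length xs + 40 \<and> opened A xs s s') s"
proof -
  obtain e xs' where e: "xs = e # xs'" using xs(4) by (cases xs) auto
  have m: "mem s A = fst e" "mem s (Suc A) = snd e"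
    using xs(1) unfolding pairs_at_def e by force+
  have eb: "fst e < W" "snd e < W" using bnd(2) e by auto
  define s1 where "s1 = set_reg ry (snd e) (set_reg rs (Suc A) (set_reg rx (fst e) s))"
  have r1: "regs s1 rx = fst e" "regs s1 ry = snd e" "regs s1 rA = A" "regs s1 rK = A + 2 * length xs"
    "mem s1 = mem s" "out s1 = out s" "regs s1 rSP = regs s rSP" "regs s1 rBase = regs s rBase"
    "regs s1 rMode = regs s rMode"
    using xs by (simp_all add: s1_def set_reg_def)
  have "wp W S choose_vertex
    (\<lambda>t s'. t \<le> 63 * length xs + 20 \<and>
      (\<exists>v w. {v, w} = {regs s1 rx, regs s1 ry} \<and>
        length (filter (avoids v v) xs) \<le> length (filter (avoids w w) xs) \<and> splits 17 A v v xs s1 s')) s1"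
    using wp_choose_vertex[of s1 A xs S W] xs bnd SP eb r1 by auto
  then have main: "wp W S (choose_vertex ;;
        Store (Reg rSP) (Reg rQ) ;; Add rSP (Reg rSP) (Const 1) ;;
        Store (Reg rSP) (Reg rK) ;; Add rSP (Reg rSP) (Const 1) ;;
        Store (Reg rSP) (Reg rQ) ;; Add rSP (Reg rSP) (Const 1) ;;
        move rK (Reg rQ))
     (\<lambda>t s'. t \<le> 63 * length xs + 30 \<and> opened A xs s s') s1"
    unfolding wp_Seq
  proof (rule wp_mono)
    fix t s2 assume 2: "t \<le> 63 * length xs + 20 \<and> (\<exists>v w. {v, w} = {regs s1 rx, regs s1 ry} \<and>
        length (filter (avoids v v) xs) \<le> length (filter (avoids w w) xs) \<and> splits 17 A v v xs s1 s2)"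
    then obtain v w zs ys where vw: "{v, w} = {fst e, snd e}"
      and deg: "length (filter (avoids v v) xs) \<le> length (filter (avoids w w) xs)"
      and p: "preserves 17 A (length xs) s1 s2"
      and zy: "pairs_at (mem s2) A (zs @ ys)" "mset zs = mset (filter (avoids v v) xs)"
       "mset ys = mset (filter (\<lambda>e. \<not> avoids v v e) xs)" "regs s2 rQ = A + 2 * length zs"
      using r1 unfolding splits_def by auto
    have r2: "regs s2 rSP = regs s rSP" "regs s2 rK = A + 2 * length xs" "regs s2 rA = regs s rA"
       "regs s2 rBase = regs s rBase" "regs s2 rMode = regs s rMode" "out s2 = out s"
       "\<And>a. \<not> (A \<le> a \<and> a < A + 2 * length xs) \<Longrightarrow> mem s2 a = mem s a"
      using p r1 xs(2) unfolding preserves_def by auto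
    have "mset (zs @ ys) = mset xs" using zy(2,3) by (simp flip: multiset_partition)
    then have len: "length zs + length ys = length xs" by (metis mset_eq_length length_append)
    have op: "opened A xs s s3"
      if "regs s3 rK = A + 2 * length zs" "regs s3 rSP = regs s rSP + 3"
     "mem s3 = (mem s2)(regs s rSP := A + 2 * length zs, regs s rSP + 1 := A + 2 * length xs,
        regs s rSP + 2 := A + 2 * length zs)"
      "\<forall>r\<in>{rA, rBase, rMode}. regs s3 r = regs s r" "out s3 = out s" for s3
    proof -
      have "pairs_at (mem s3) A (zs @ ys)"
        by (rule pairs_at_cong[OF zy(1)]) (use that(3) SP len in auto)
      then show ?thesis
        unfolding opened_def
        apply (intro conjI)
        apply (rule exI[of _ zs], rule exI[of _ ys], rule exI[of _ v], rule exI[of _ w])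
        using that zy deg vw r2 e by (simp_all add: edge_def)
    qed
    show "wp W S (Store (Reg rSP) (Reg rQ)) (\<lambda>t'. wp W S (Add rSP (Reg rSP) (Const 1)) (\<lambda>t'a.
      wp W S (Store (Reg rSP) (Reg rK)) (\<lambda>t'b. wp W S (Add rSP (Reg rSP) (Const 1)) (\<lambda>t'c.
      wp W S (Store (Reg rSP) (Reg rQ)) (\<lambda>t'd. wp W S (Add rSP (Reg rSP) (Const 1)) (\<lambda>t'e.
      wp W S (move rK (Reg rQ)) (\<lambda>t'f s'. t + (t' + (t'a + (t'b + (t'c + (t'd + (t'e + t'f)))))) \<le> 63 * length xs + 30 \<and>
         opened A xs s s'))))))) s2"
      using r2 zy(4) len SP bnd 2 by (simp add: move_def set_reg_def op)
  qed
  \<comment> \<open>The 4 units are the emptiness test and the three instructions that fetch the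
    first edge.\<close>
  have "wp W S (choose_vertex ;;
        Store (Reg rSP) (Reg rQ) ;; Add rSP (Reg rSP) (Const 1) ;;
        Store (Reg rSP) (Reg rK) ;; Add rSP (Reg rSP) (Const 1) ;;
        Store (Reg rSP) (Reg rQ) ;; Add rSP (Reg rSP) (Const 1) ;;
        move rK (Reg rQ))
     (\<lambda>t s'. 4 + t \<le> 63 * length xs + 40 \<and> opened A xs s s') s1"
    by (rule wp_mono[OF main]) simp
  moreover obtain rest where rest: "rest = choose_vertex ;;
        Store (Reg rSP) (Reg rQ) ;; Add rSP (Reg rSP) (Const 1) ;;
        Store (Reg rSP) (Reg rK) ;; Add rSP (Reg rSP) (Const 1) ;;
        Store (Reg rSP) (Reg rQ) ;; Add rSP (Reg rSP) (Const 1) ;;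
        move rK (Reg rQ)" by blast
  ultimately have "wp W S rest (\<lambda>t s'. 4 + t \<le> 63 * length xs + 40 \<and> opened A xs s s') s1" by simp
  then show ?thesis
    unfolding call_step_def rest[symmetric]
    using xs m eb bnd SP e by (simp add: set_reg_def s1_def)
qed

section \<open>Trying the edges at the chosen vertex one by one\<close>

definition removal :: "(nat \<times> nat) list \<Rightarrow> nat list" where
  "removal ds = (if ds = [] then [] else [2, fst (last ds), snd (last ds)])"

text \<open>\<open>ds\<close> are the edges at the chosen vertex already tried, \<open>es\<close>
  those still to come. The last of \<open>ds\<close> is removed from the current set only at the
  next visit. Three words per edge of \<open>zs\<close> are reserved for deeper frames, which
  suffices because every level has fewer edges.\<close>

definition frame_at :: "nat \<Rightarrow> nat \<Rightarrow> nat \<Rightarrow> nat \<Rightarrow> nat \<Rightarrow> (nat \<times> nat) list \<Rightarrow> (nat \<times> nat) list \<Rightarrow>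
    (nat \<times> nat) list \<Rightarrow> state \<Rightarrow> bool" where
  "frame_at W S A B p zs ds es s \<longleftrightarrow>
     regs s rMode = 1 \<and> regs s rA = A \<and> regs s rBase = B \<and> regs s rSP = p + 3 \<and>
     mem s p = A + 2 * length zs \<and> mem s (p + 1) = A + 2 * length (zs @ ds @ es) \<and>
     mem s (p + 2) = A + 2 * length (zs @ ds) \<and> pairs_at (mem s) A (zs @ ds @ es) \<and>
     A + 2 * length (zs @ ds @ es) \<le> B \<and> B \<le> p \<and> p + 3 + 3 * length zs \<le> S \<and> S + 4 \<le> W \<and>
     (\<forall>e \<in> set (zs @ ds @ es). fst e < W \<and> snd e < W)"

lemma pairs_at_nth:
  "pairs_at m A (xs @ e # ys) \<Longrightarrow>
    m (A + 2 * length xs) = fst e \<and> m (Suc (A + 2 * length xs)) = snd e"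
  unfolding pairs_at_def by (force dest: spec[of _ "length xs"])

text \<open>Popping leaves \<open>rMode\<close> at 1, so the next iteration continues in the frame
  of the parent.\<close>

lemma wp_return_last:
  assumes "frame_at W S A B p zs ds [] s"
  shows "wp W S return_step (\<lambda>t s'. t \<le> 30 \<and> mem s' = mem s \<and> regs s' rSP = p \<and>
    (\<forall>r\<in>{rA, rBase, rMode}. regs s' r = regs s r) \<and> out s' = out s @ removal ds) s"
proof (cases ds rule: rev_cases)
  case Nil
  then show ?thesis
    using assms unfolding frame_at_def
    by (simp add: return_step_def set_reg_def removal_def)
next
  case (snoc us d)
  then have "mem s (A + 2 * length (zs @ us)) = fst d \<and> mem s (Suc (A + 2 * length (zs @ us))) = snd d"
    using assms pairs_at_nth[of "mem s" A "zs @ us" d "[]"] unfolding frame_at_def by simp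
  moreover have "fst d < W" "snd d < W" using assms snoc unfolding frame_at_def by auto
  ultimately show ?thesis
    using assms snoc unfolding frame_at_def
    by (simp add: return_step_def set_reg_def removal_def algebra_simps)
qed

definition advanced :: "nat \<Rightarrow> nat \<Rightarrow> (nat \<times> nat) list \<Rightarrow> (nat \<times> nat) list \<Rightarrow> nat \<times> nat \<Rightarrow>
    (nat \<times> nat) list \<Rightarrow> state \<Rightarrow> state \<Rightarrow> bool" where
  "advanced A p zs ds e es s s' \<longleftrightarrow> (\<exists>us vs. pairs_at (mem s') A ((us @ vs) @ ds @ e # es) \<and>
     mset us = mset (filter (disjoint_edges e) zs) \<and> mset (us @ vs) = mset zs \<and>
     regs s' rK = A + 2 * length us) \<and>
   regs s' rMode = 0 \<and> (\<forall>r\<in>{rA, rBase, rSP}. regs s' r = regs s r) \<and>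
   mem s' p = mem s p \<and> mem s' (p + 1) = mem s (p + 1) \<and> mem s' (p + 2) = mem s (p + 2) + 2 \<and>
   (\<forall>a < p. \<not> (A \<le> a \<and> a < A + 2 * length zs) \<longrightarrow> mem s' a = mem s a) \<and>
   out s' = out s @ removal ds @ [1, fst e, snd e]"

text \<open>The partition touches only the words of \<open>zs\<close>, so the edges at the vertex
  and the frame above the array survive; the frame changes just in its third pointer, by the two
  words of one edge.\<close>

lemma wp_return_next:
  assumes "frame_at W S A B p zs ds (e # es) s"
  shows "wp W S return_step (\<lambda>t s'. t \<le> 21 * length zs + 40 \<and> advanced A p zs ds e es s s') s"
proof -
  define i where "i = A + 2 * length (zs @ ds)"
  have fr: "regs s rMode = 1" "regs s rA = A" "regs s rBase = B" "regs s rSP = p + 3"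
     "mem s p = A + 2 * length zs" "mem s (p + 1) = A + 2 * length (zs @ ds @ e # es)"
     "mem s (p + 2) = i" "pairs_at (mem s) A (zs @ ds @ e # es)"
     "A + 2 * length (zs @ ds @ e # es) \<le> B" "B \<le> p" "p + 3 + 3 * length zs \<le> S" "S + 4 \<le> W"
     "(\<forall>e \<in> set (zs @ ds @ e # es). fst e < W \<and> snd e < W)"
    using assms unfolding frame_at_def i_def by auto
  have me: "mem s i = fst e" "mem s (Suc i) = snd e"
    using pairs_at_nth[of "mem s" A "zs @ ds" e es] fr(8) by (simp_all add: i_def)
  have eb: "fst e < W" "snd e < W" using fr(13) by auto
  define P where "P = (\<lambda>s1 :: state. regs s1 rU = fst e \<and> regs s1 rV = snd e \<and> regs s1 rK = A + 2 * length zs \<and>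
     mem s1 = (mem s)(p + 2 := i + 2) \<and> out s1 = out s @ removal ds @ [1, fst e, snd e] \<and>
    (\<forall>r\<in>{rA, rBase, rSP}. regs s1 r = regs s r))"
  have part: "wp W S partition_prefix (\<lambda>t. wp W S (move rK (Reg rQ)) (\<lambda>t'. wp W S (move rMode (Const 0))
     (\<lambda>t'' s'. t0 + (t + (t' + t'')) \<le> 21 * length zs + 20 \<and> advanced A p zs ds e es s s'))) s1"
    if P: "P s1" and t0: "t0 \<le> 12" for s1 t0
  proof (rule wp_mono[OF wp_partition_splits[of s1 A zs]])
    have "pairs_at (mem s) A zs" using fr(8) pairs_at_append by blast
    then show "pairs_at (mem s1) A zs"
      by (rule pairs_at_cong) (use P fr in \<open>auto simp: P_def\<close>)
    fix t s2 assume 2: "t \<le> 21 * length zs + 3 \<and> splits 16 A (regs s1 rU) (regs s1 rV) zs s1 s2"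
    then obtain us vs where p: "preserves 16 A (length zs) s1 s2"
      and uv: "pairs_at (mem s2) A (us @ vs)" "mset us = mset (filter (disjoint_edges e) zs)"
       "mset vs = mset (filter (\<lambda>x. \<not> disjoint_edges e x) zs)" "regs s2 rQ = A + 2 * length us"
      using P unfolding splits_def P_def by auto
    have uvz: "mset (us @ vs) = mset zs" using uv(2,3) by (simp flip: multiset_partition)
    then have len: "length us + length vs = length zs" by (metis mset_eq_length length_append)
    have "pairs_at (mem s) (A + 2 * length zs) (ds @ e # es)" using fr(8) pairs_at_append by blast
    then have "pairs_at (mem s2) (A + 2 * length zs) (ds @ e # es)"
      by (rule pairs_at_cong) (use P p fr in \<open>auto simp: P_def preserves_def\<close>)
    then have pa: "pairs_at (mem s2) A ((us @ vs) @ ds @ e # es)"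
      using uv(1) len by (subst pairs_at_append) simp
    have mem2: "mem s2 p = mem s p" "mem s2 (p + 1) = mem s (p + 1)" "mem s2 (p + 2) = mem s (p + 2) + 2"
      "\<And>a. a < p \<Longrightarrow> \<not> (A \<le> a \<and> a < A + 2 * length zs) \<Longrightarrow> mem s2 a = mem s a"
      using P p fr unfolding P_def preserves_def by auto
    have "advanced A p zs ds e es s s3" if "mem s3 = mem s2" "out s3 = out s2"
       "regs s3 rK = A + 2 * length us" "regs s3 rMode = 0" "\<forall>r\<in>{rA, rBase, rSP}. regs s3 r = regs s2 r" for s3
      unfolding advanced_def that(1)
      apply (intro conjI)
      apply (rule exI[of _ us], rule exI[of _ vs])
      using pa uv(2) uvz mem2 P p that by (simp_all add: P_def preserves_def)
    moreover have "regs s2 rQ + 0 < W" using uv(4) len fr by simp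
    ultimately show "wp W S (move rK (Reg rQ)) (\<lambda>t'. wp W S (move rMode (Const 0))
     (\<lambda>t'' s'. t0 + (t + (t' + t'')) \<le> 21 * length zs + 20 \<and> advanced A p zs ds e es s s')) s2"
      using uv(4) 2 t0 by (simp add: move_def set_reg_def)
  qed (use P fr in \<open>auto simp: P_def\<close>)
  obtain R where R: "R = partition_prefix ;; move rK (Reg rQ) ;; move rMode (Const 0)" by blast
  \<comment> \<open>12 bounds the test and the ten instructions of \<open>T\<close> before the
    partition.\<close>
  have part': "wp W S R (\<lambda>t s'. 12 + t \<le> 21 * length zs + 20 \<and> advanced A p zs ds e es s s') s1"
    if "P s1" for s1
    using part[OF that, of 12] unfolding R wp_Seq by simp
  obtain T where T: "T = IfElse (Equal (Reg rI) (Reg rHi))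
          (Sub rSP (Reg rSP) (Const 3))
          (Load rU (Reg rI) ;; Add rs (Reg rI) (Const 1) ;; Load rV (Reg rs) ;;
           Output (Const 1) ;; Output (Reg rU) ;; Output (Reg rV) ;;
           Add rI (Reg rI) (Const 2) ;; Sub rs (Reg rSP) (Const 1) ;; Store (Reg rs) (Reg rI) ;;
           move rK (Reg rLo) ;; partition_prefix ;;
           move rK (Reg rQ) ;; move rMode (Const 0))" by blast
  have tail: "wp W S T (\<lambda>t s'. t \<le> 21 * length zs + 20 \<and> advanced A p zs ds e es s s') s1"
    if s1: "regs s1 rLo = A + 2 * length zs" "regs s1 rHi = A + 2 * length (zs @ ds @ e # es)"
      "regs s1 rI = i" "mem s1 = mem s" "out s1 = out s @ removal ds"
      "\<forall>r\<in>{rA, rBase, rSP}. regs s1 r = regs s r" for s1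
    unfolding T R[symmetric] using s1 fr eb me
    apply (simp add: set_reg_def move_def i_def)
    apply (rule wp_mono[OF part'])
    by (simp_all add: P_def i_def)
  show ?thesis
  proof (cases ds rule: rev_cases)
    case Nil
    then show ?thesis
      using fr me eb unfolding i_def return_step_def T[symmetric]
      apply (simp add: set_reg_def move_def)
      apply (rule wp_mono[OF tail])
      by (auto simp add: removal_def i_def algebra_simps)
  next
    case (snoc us d)
    then have "mem s (A + 2 * length (zs @ us)) = fst d \<and> mem s (Suc (A + 2 * length (zs @ us))) = snd d"
      using fr(8) pairs_at_nth[of "mem s" A "zs @ us" d "e # es"] by simp
    moreover have "fst d < W" "snd d < W" using fr(13) snoc by auto
    ultimately show ?thesis
      using fr me eb snoc unfolding i_def return_step_def T[symmetric]
      apply (simp add: set_reg_def move_def algebra_simps)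
      apply (rule wp_mono[OF tail])
      by (auto simp add: removal_def i_def algebra_simps)
  qed
qed

subsection \<open>Enumeration\<close>

text \<open>The recursion is simulated by a single loop, so a completed call is only a segment of
  its run. Quantifying over the rest of the run lets such segments be chained.\<close>

definition reaches :: "nat \<Rightarrow> nat \<Rightarrow> state \<Rightarrow> nat \<Rightarrow> state \<Rightarrow> bool" where
  "reaches W S s t s' \<longleftrightarrow> (\<forall>u r. exec W S main_loop s' u r \<longrightarrow> exec W S main_loop s (t + u) r)"

lemma reaches_trans: "reaches W S s t s' \<Longrightarrow> reaches W S s' u s'' \<Longrightarrow> reaches W S s (t + u) s''"
  unfolding reaches_def by (metis add.assoc)

lemma reaches_step:
  assumes "regs s rMode < 2" "wp W S main_body R s"
  shows "\<exists>t s'. reaches W S s (1 + t) s' \<and> R t s'"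
proof -
  from assms(2) obtain t s' where *: "exec W S main_body s t s'" "R t s'"
    unfolding wp_def by blast
  have "reaches W S s (1 + t) s'"
    unfolding reaches_def main_loop_def
    using WhileTrue[OF _ *(1)] assms(1) by auto
  then show ?thesis using *(2) by blast
qed

text \<open>Three stack words per edge cover the whole recursion, because each frame is opened for a
  strictly shorter prefix.\<close>

definition calling :: "nat \<Rightarrow> nat \<Rightarrow> nat \<Rightarrow> nat \<Rightarrow> (nat \<times> nat) list \<Rightarrow> state \<Rightarrow> bool" where
  "calling W S A B xs s \<longleftrightarrow>
     regs s rMode = 0 \<and> regs s rA = A \<and> regs s rBase = B \<and> regs s rK = A + 2 * length xs \<and>
     pairs_at (mem s) A xs \<and> A + 2 * length xs \<le> B \<and> B \<le> regs s rSP \<and>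
     regs s rSP + 3 * length xs \<le> S \<and> S + 4 \<le> W \<and>
     (\<forall>e \<in> set xs. fst e < W \<and> snd e < W) \<and> proper xs"

text \<open>\<open>M\<close> is the set of edges chosen by the ancestors: the same commands
  \<open>ws\<close> report \<open>M\<close> extended by each matching and then restore
  \<open>M\<close>. In the time bound each matching brings 345 credits, of which 126 per edge and
  340 more stay unspent for the caller; additive form avoids truncated subtraction.\<close>

definition returned :: "nat \<Rightarrow> (nat \<times> nat) list \<Rightarrow> state \<Rightarrow> nat \<Rightarrow> state \<Rightarrow> bool" where
  "returned A xs s t s' \<longleftrightarrow> (\<exists>ys ws Ns. mset ys = mset xs \<and> pairs_at (mem s') A ys \<and>
     out s' = out s @ ws \<and> distinct Ns \<and> set Ns = {N. matching (edges xs) N} \<and>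
     (\<forall>M. M \<inter> edges xs = {} \<longrightarrow> transforms M ws (map ((\<union>) M) Ns) M) \<and>
     t + 126 * length xs + 340 \<le> 345 * length Ns) \<and>
   regs s' rMode = 1 \<and> (\<forall>r\<in>{rA, rBase, rSP}. regs s' r = regs s r) \<and>
   (\<forall>a < regs s rSP. \<not> (A \<le> a \<and> a < A + 2 * length xs) \<longrightarrow> mem s' a = mem s a)"

text \<open>The last tried edge is still present at the start, and its removal belongs to
  \<open>ws\<close>. The sum is the credit left over by the children; the allowance is
  \<open>21 * length zs + 42\<close> for starting each child and 32 for popping the frame, with loop
  tests included.\<close>

definition frame_done :: "nat \<Rightarrow> nat \<Rightarrow> (nat \<times> nat) list \<Rightarrow> (nat \<times> nat) list \<Rightarrow>
    (nat \<times> nat) list \<Rightarrow> state \<Rightarrow> nat \<Rightarrow> state \<Rightarrow> bool" where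
  "frame_done A p zs ds es s t s' \<longleftrightarrow>
   (\<exists>zs' ws Ns. mset zs' = mset zs \<and> pairs_at (mem s') A (zs' @ ds @ es) \<and>
     out s' = out s @ ws \<and> distinct Ns \<and> set Ns = (\<Union>e\<in>set es. branch zs e) \<and>
     (\<forall>M. M \<inter> edges (zs @ ds @ es) = {} \<longrightarrow>
       transforms (if ds = [] then M else insert (edge (last ds)) M) ws (map ((\<union>) M) Ns) M) \<and>
     t + (\<Sum>e\<leftarrow>es. 126 * length (filter (disjoint_edges e) zs) + 340)
       \<le> 345 * length Ns + length es * (21 * length zs + 42) + 32) \<and>
   regs s' rMode = 1 \<and> (\<forall>r\<in>{rA, rBase}. regs s' r = regs s r) \<and> regs s' rSP = p \<and>
   (\<forall>a < p. \<not> (A \<le> a \<and> a < A + 2 * length zs) \<longrightarrow> mem s' a = mem s a)"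

lemma transforms_removal:
  assumes "M \<inter> edges ds = {}"
  shows "transforms (if ds = [] then M else insert (edge (last ds)) M) (removal ds) [] M"
proof (cases "ds = []")
  case True
  then show ?thesis by (simp add: removal_def transforms_Nil)
next
  case False
  then have "edge (last ds) \<notin> M" using assms by (auto simp: edges_def)
  then have "insert (edge (last ds)) M - {{fst (last ds), snd (last ds)}} = M"
    by (auto simp: edge_def)
  then show ?thesis
    using False transforms_remove[of "insert (edge (last ds)) M" "fst (last ds)" "snd (last ds)"]
    by (simp add: removal_def)
qed

lemma edges_append: "edges (xs @ ys) = edges xs \<union> edges ys"
  by (auto simp: edges_def)

text \<open>Induction on the untried edges, with \<open>IH\<close> supplying the recursive calls on
  shorter prefixes. A child permutes part of \<open>zs\<close>, and the tried edge moves to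
  \<open>ds\<close>, so both are generalised.\<close>

lemma frame_loop:
  assumes IH: "\<And>us s. length us \<le> n \<Longrightarrow> calling W S A B us s \<Longrightarrow>
      \<exists>t s'. reaches W S s t s' \<and> returned A us s t s'"
    and "frame_at W S A B p zs ds es s" "length zs \<le> n" "proper (zs @ ds @ es)"
  shows "\<exists>t s'. reaches W S s t s' \<and> frame_done A p zs ds es s t s'"
  using assms(2-)
proof (induction es arbitrary: zs ds s)
  case Nil
  have mode: "regs s rMode = 1" using Nil(1) unfolding frame_at_def by simp
  have "wp W S main_body (\<lambda>t s'. t \<le> 31 \<and> mem s' = mem s \<and> regs s' rSP = p \<and>
    (\<forall>r\<in>{rA, rBase, rMode}. regs s' r = regs s r) \<and> out s' = out s @ removal ds) s"
    unfolding main_body_def using mode wp_return_last[OF Nil(1)]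
    by (simp add: wp_mono)
  from reaches_step[OF _ this] mode obtain t s' where t: "reaches W S s (1 + t) s'" "t \<le> 31" and s': "mem s' = mem s" "regs s' rSP = p"
    "\<forall>r\<in>{rA, rBase, rMode}. regs s' r = regs s r" "out s' = out s @ removal ds"
    by auto
  have "pairs_at (mem s') A (zs @ ds @ [])"
    using Nil(1) s'(1) unfolding frame_at_def by simp
  moreover have "\<forall>M. M \<inter> edges (zs @ ds @ []) = {} \<longrightarrow>
      transforms (if ds = [] then M else insert (edge (last ds)) M) (removal ds) (map ((\<union>) M) []) M"
    using transforms_removal[of _ ds] by (simp add: edges_append Int_Un_distrib)
  ultimately have "frame_done A p zs ds [] s (1 + t) s'"
    unfolding frame_done_def using s' mode t(2)
    by (intro conjI exI[of _ zs] exI[of _ "removal ds"] exI[of _ "[]"]) simp_all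
  then show ?case using t(1) by blast
next
  case (Cons e es)
  have fr: "regs s rMode = 1" "regs s rA = A" "regs s rBase = B" "regs s rSP = p + 3"
     "mem s p = A + 2 * length zs" "mem s (p + 1) = A + 2 * length (zs @ ds @ e # es)"
     "mem s (p + 2) = A + 2 * length (zs @ ds)"
     "A + 2 * length (zs @ ds @ e # es) \<le> B" "B \<le> p" "p + 3 + 3 * length zs \<le> S" "S + 4 \<le> W"
     "(\<forall>e \<in> set (zs @ ds @ e # es). fst e < W \<and> snd e < W)"
    using Cons.prems(1) unfolding frame_at_def by auto
  have "wp W S main_body (\<lambda>t s'. t \<le> 21 * length zs + 41 \<and> advanced A p zs ds e es s s') s"
    unfolding main_body_def using fr(1) wp_return_next[OF Cons.prems(1)]
    by (simp add: wp_mono)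
  from reaches_step[OF _ this] fr(1) obtain t1 s1 where t1: "reaches W S s (1 + t1) s1" "t1 \<le> 21 * length zs + 41"
    and "advanced A p zs ds e es s s1"
    by auto
  then obtain us vs where pa1: "pairs_at (mem s1) A ((us @ vs) @ ds @ e # es)"
    and us: "mset us = mset (filter (disjoint_edges e) zs)" and uv: "mset (us @ vs) = mset zs"
    and r1: "regs s1 rK = A + 2 * length us" "regs s1 rMode = 0" "\<forall>r\<in>{rA, rBase, rSP}. regs s1 r = regs s r"
    and m1: "mem s1 p = mem s p" "mem s1 (p + 1) = mem s (p + 1)" "mem s1 (p + 2) = mem s (p + 2) + 2"
    "\<forall>a < p. \<not> (A \<le> a \<and> a < A + 2 * length zs) \<longrightarrow> mem s1 a = mem s a"
    and o1: "out s1 = out s @ removal ds @ [1, fst e, snd e]"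
    unfolding advanced_def by blast
  have luv: "length us + length vs = length zs" using uv by (metis mset_eq_length length_append)
  have lus: "length us = length (filter (disjoint_edges e) zs)" using us by (rule mset_eq_length)
  have suv: "set us \<union> set vs = set zs" using uv by (metis set_append set_mset_mset)
  have "proper zs" using Cons.prems(3) by (auto simp: proper_def)
  then have pus: "proper us" using proper_filter proper_mset[OF us] by blast
  have "calling W S A B us s1"
    unfolding calling_def using r1 fr pa1 luv suv pus by (auto simp: pairs_at_append)
  then obtain t2 s2 where t2: "reaches W S s1 t2 s2" and "returned A us s1 t2 s2"
    using IH[of us s1] luv Cons.prems(2) by auto
  then obtain us' ws2 Ns2 where us': "mset us' = mset us" "pairs_at (mem s2) A us'"
    and o2: "out s2 = out s1 @ ws2" and Ns2: "distinct Ns2" "set Ns2 = {N. matching (edges us) N}"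
    and tr2: "\<And>M. M \<inter> edges us = {} \<Longrightarrow> transforms M ws2 (map ((\<union>) M) Ns2) M"
    and c2: "t2 + 126 * length us + 340 \<le> 345 * length Ns2"
    and r2: "regs s2 rMode = 1" "\<forall>r\<in>{rA, rBase, rSP}. regs s2 r = regs s1 r"
    and m2: "\<forall>a < regs s1 rSP. \<not> (A \<le> a \<and> a < A + 2 * length us) \<longrightarrow> mem s2 a = mem s1 a"
    unfolding returned_def by blast
  let ?zs = "us' @ vs"
  have lus': "length us' = length us" using us'(1) by (rule mset_eq_length)
  have mz: "mset ?zs = mset zs" using us'(1) uv by simp
  have sz: "set ?zs = set zs" using mz by (metis set_mset_mset)
  have sp1: "regs s1 rSP = p + 3" using r1 fr by simp
  have "pairs_at (mem s1) (A + 2 * length us') (vs @ ds @ e # es)"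
    using pa1 lus' by (simp add: pairs_at_append[of _ _ us])
  then have "pairs_at (mem s2) (A + 2 * length us') (vs @ ds @ e # es)"
    by (rule pairs_at_cong) (use m2 sp1 fr luv lus' in auto)
  then have pa2: "pairs_at (mem s2) A (?zs @ (ds @ [e]) @ es)"
    using us'(2) by (simp add: pairs_at_append[of _ _ us'])
  have m2': "mem s2 p = mem s p" "mem s2 (p + 1) = mem s (p + 1)" "mem s2 (p + 2) = mem s (p + 2) + 2"
    using m2 m1 sp1 fr luv by auto
  have "set (?zs @ (ds @ [e]) @ es) = set (zs @ ds @ e # es)"
    using sz by auto
  then have "\<forall>x \<in> set (?zs @ (ds @ [e]) @ es). fst x < W \<and> snd x < W"
    using fr(12) by metis
  then have "frame_at W S A B p ?zs (ds @ [e]) es s2"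
    unfolding frame_at_def
    using r2 r1 fr(1-11) m2' pa2 lus' luv by (intro conjI) simp_all
  moreover have "proper (?zs @ (ds @ [e]) @ es)"
  proof -
    have "mset (?zs @ (ds @ [e]) @ es) = mset (zs @ ds @ e # es)" using mz by simp
    then show ?thesis using Cons.prems(3) proper_mset by blast
  qed
  ultimately obtain t3 s3 where t3: "reaches W S s2 t3 s3" and "frame_done A p ?zs (ds @ [e]) es s2 t3 s3"
    using Cons.IH[of ?zs "ds @ [e]" s2] luv lus' Cons.prems(2) by auto
  then obtain zs3 ws3 Ns3 where zs3: "mset zs3 = mset ?zs" "pairs_at (mem s3) A (zs3 @ (ds @ [e]) @ es)"
    and o3: "out s3 = out s2 @ ws3" and Ns3: "distinct Ns3" "set Ns3 = (\<Union>e\<in>set es. branch ?zs e)"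
    and tr3: "\<And>M. M \<inter> edges (?zs @ (ds @ [e]) @ es) = {} \<Longrightarrow>
       transforms (if ds @ [e] = [] then M else insert (edge (last (ds @ [e]))) M) ws3 (map ((\<union>) M) Ns3) M"
    and c3: "t3 + (\<Sum>e\<leftarrow>es. 126 * length (filter (disjoint_edges e) ?zs) + 340)
       \<le> 345 * length Ns3 + length es * (21 * length ?zs + 42) + 32"
    and r3: "regs s3 rMode = 1" "\<forall>r\<in>{rA, rBase}. regs s3 r = regs s2 r" "regs s3 rSP = p"
    and m3: "\<forall>a < p. \<not> (A \<le> a \<and> a < A + 2 * length ?zs) \<longrightarrow> mem s3 a = mem s2 a"
    unfolding frame_done_def by blast
  have lf: "length (filter (disjoint_edges e') ?zs) = length (filter (disjoint_edges e') zs)" for e'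
    using mz by (metis mset_eq_length mset_filter)
  have lzs: "length ?zs = length zs" using luv lus' by simp
  \<comment> \<open>By \<open>proper\<close>, \<open>e\<close> can occur in no later branch, which
    keeps the reported matchings distinct.\<close>
  have eNot: "edge e \<notin> edges zs" "edge e \<notin> edge ` set es"
    using Cons.prems(3) by (auto simp: proper_def edges_def)
  have eus: "edges us = edges (filter (disjoint_edges e) zs)" using us by (rule edges_mset)
  let ?Ns = "map (insert (edge e)) Ns2 @ Ns3"
  have setNs: "set ?Ns = (\<Union>e\<in>set (e # es). branch zs e)"
    using Ns2(2) Ns3(2) eus branch_mset[OF mz] by (simp add: branch_def)
  have "distinct (map (insert (edge e)) Ns2)"
    using Ns2 inj_on_insert_branch[OF eNot(1)] eus by (simp add: distinct_map)
  moreover have "edge e \<notin> N" if N: "N \<in> set Ns3" for N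
  proof -
    obtain e' where e': "e' \<in> set es" "N \<in> branch zs e'"
      using N Ns3(2) branch_mset[OF mz] by auto
    then show ?thesis using branch_member(2)[OF e'(2)] eNot by auto
  qed
  ultimately have "distinct ?Ns" using Ns3(1) by auto
  moreover have "transforms (if ds = [] then M else insert (edge (last ds)) M)
      (removal ds @ [1, fst e, snd e] @ ws2 @ ws3) (map ((\<union>) M) ?Ns) M"
    if M: "M \<inter> edges (zs @ ds @ e # es) = {}" for M
  proof -
    have 1: "transforms (if ds = [] then M else insert (edge (last ds)) M) (removal ds) [] M"
      using M by (intro transforms_removal) (auto simp: edges_append)
    have 2: "transforms M [1, fst e, snd e] [] (insert (edge e) M)"
      unfolding edge_def by (rule transforms_insert)
    have "insert (edge e) M \<inter> edges us = {}"
      using M eNot(1) unfolding eus by (auto simp: edges_def)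
    then have 3: "transforms (insert (edge e) M) ws2 (map ((\<union>) (insert (edge e) M)) Ns2) (insert (edge e) M)"
      by (rule tr2)
    have "mset (?zs @ (ds @ [e]) @ es) = mset (zs @ ds @ e # es)" using mz by simp
    then have "M \<inter> edges (?zs @ (ds @ [e]) @ es) = {}"
      using M edges_mset by metis
    \<comment> \<open>The removal of \<open>e\<close> is the first thing done by \<open>ws3\<close>,
      as \<open>e\<close> is now the last tried edge.\<close>
    then have 4: "transforms (insert (edge e) M) ws3 (map ((\<union>) M) Ns3) M"
      using tr3 by fastforce
    have eq: "map ((\<union>) M) ?Ns = map ((\<union>) (insert (edge e) M)) Ns2 @ map ((\<union>) M) Ns3"
      by simp
    show ?thesis
      unfolding eq using transforms_append[OF 1 transforms_append[OF 2 transforms_append[OF 3 4]]] by simp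
  qed
  moreover have "mset zs3 = mset zs" using zs3(1) mz by simp
  moreover have "pairs_at (mem s3) A (zs3 @ ds @ e # es)" using zs3(2) by simp
  moreover have "out s3 = out s @ (removal ds @ [1, fst e, snd e] @ ws2 @ ws3)"
    using o1 o2 o3 by simp
  moreover have "(1 + t1 + t2 + t3) + (\<Sum>e\<leftarrow>e # es. 126 * length (filter (disjoint_edges e) zs) + 340)
       \<le> 345 * length ?Ns + length (e # es) * (21 * length zs + 42) + 32"
    using t1(2) c2[unfolded lus] c3[unfolded lf lzs] by simp
  moreover have "\<forall>a < p. \<not> (A \<le> a \<and> a < A + 2 * length zs) \<longrightarrow> mem s3 a = mem s a"
    using m3 m2 m1(4) sp1 luv lus' by auto
  ultimately have "frame_done A p zs ds (e # es) s (1 + t1 + t2 + t3) s3"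
    unfolding frame_done_def using setNs r3 r2(2) r1(3)
    by (intro conjI exI[of _ zs3] exI[of _ "removal ds @ [1, fst e, snd e] @ ws2 @ ws3"] exI[of _ ?Ns]) auto
  moreover have "reaches W S s (1 + t1 + t2 + t3) s3"
    using reaches_trans[OF reaches_trans[OF t1(1) t2] t3] .
  ultimately show ?case by blast
qed


text \<open>Here \<open>l\<close> edges avoid the vertex, \<open>d\<close> contain it, and
  \<open>L\<close> is the total loss; index 0 belongs to the child leaving the vertex unmatched,
  index 1 to all others. After cancelling the credits, the case \<open>d = 3\<close> with
  \<open>L = 2 * l\<close> balances the terms in \<open>l\<close> exactly: 63 + 252 + 63 =
  378.\<close>

lemma node_cost:
  fixes l d L n\<^sub>0 n\<^sub>1 t\<^sub>0 t\<^sub>1 :: nat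
  assumes d: "d \<noteq> 0" and L: "L \<le> 2 * l" "d = 2 \<Longrightarrow> L \<le> l + 1" "d = 1 \<Longrightarrow> L = 0"
    and t0: "t\<^sub>0 + 126 * l + 340 \<le> 345 * n\<^sub>0"
    and t1: "t\<^sub>1 + 126 * (d * l) + 340 * d \<le> 345 * n\<^sub>1 + 126 * L + d * (21 * l + 42) + 32"
  shows "(63 * (l + d) + 42) + t\<^sub>0 + t\<^sub>1 + 126 * (l + d) + 340 \<le> 345 * (n\<^sub>0 + n\<^sub>1)"
proof -
  consider "d = 1" | "d = 2" | "3 \<le> d" using d by linarith
  then have "63 * l + 105 * d + 21 * (d * l) + 74 + 126 * d + 126 * L \<le> 126 * (d * l) + 340 * d"
  proof cases
    case 3
    then have "3 * l \<le> d * l" by simp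
    then show ?thesis using L(1) 3 by linarith
  qed (use L in auto)
  then show ?thesis using t0 t1 by (simp add: algebra_simps)
qed

text \<open>Strong induction on the number of edges: a nonempty prefix is opened, the child leaving
  the vertex unmatched is run, and \<open>frame_loop\<close> handles the edges at the
  vertex.\<close>

lemma matchings_enumerated:
  "calling W S A B xs s \<Longrightarrow> \<exists>t s'. reaches W S s t s' \<and> returned A xs s t s'"
proof (induction "length xs" arbitrary: xs s rule: less_induct)
  case less
  have fr: "regs s rMode = 0" "regs s rA = A" "regs s rBase = B" "regs s rK = A + 2 * length xs"
     "pairs_at (mem s) A xs" "A + 2 * length xs \<le> B" "B \<le> regs s rSP"
     "regs s rSP + 3 * length xs \<le> S" "S + 4 \<le> W"
     "\<forall>e \<in> set xs. fst e < W \<and> snd e < W" "proper xs"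
    using less.prems unfolding calling_def by auto
  show ?case
  proof (cases "xs = []")
    case True
    have "wp W S main_body (\<lambda>t s'. t \<le> 4 \<and> mem s' = mem s \<and> regs s' rMode = 1 \<and>
      (\<forall>r\<in>{rA, rBase, rSP}. regs s' r = regs s r) \<and> out s' = out s @ [0]) s"
      using fr True by (simp add: main_body_def call_step_def move_def set_reg_def)
    from reaches_step[OF _ this] fr(1) obtain t s' where t: "reaches W S s (1 + t) s'" "t \<le> 4"
      and s': "mem s' = mem s" "regs s' rMode = 1" "\<forall>r\<in>{rA, rBase, rSP}. regs s' r = regs s r"
        "out s' = out s @ [0]"
      by auto
    have "{N. matching (edges xs) N} = {{}}"
      using True by (auto simp: matching_def edges_def)
    \<comment> \<open>A leaf takes at most 5 units and reports one matching, so 5 + 340 = 345 is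
      exactly tight.\<close>
    then have "returned A xs s (1 + t) s'"
      unfolding returned_def using s' t(2) True transforms_report fr(5)
      by (intro conjI exI[of _ xs] exI[of _ "[0]"] exI[of _ "[{}]"]) auto
    then show ?thesis using t(1) by blast
  next
    case False
    then have "length xs \<ge> 1" by (cases xs) auto
    then have SP: "A + 2 * length xs \<le> regs s rSP" "regs s rSP + 3 \<le> S" using fr by linarith+
    have "wp W S main_body (\<lambda>t s'. t \<le> 63 * length xs + 41 \<and> opened A xs s s') s"
      unfolding main_body_def
      using fr(1) wp_call_step[OF fr(5,2,4) False fr(9,10) SP] by (simp add: wp_mono)
    from reaches_step[OF _ this] fr(1) obtain t1 s1 where
      t1: "reaches W S s (1 + t1) s1" "t1 \<le> 63 * length xs + 41" and "opened A xs s s1"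
      by auto
    then obtain zs ys v w where pa1: "pairs_at (mem s1) A (zs @ ys)"
      and zs: "mset zs = mset (filter (avoids v v) xs)" and ys: "mset ys = mset (filter (\<lambda>e. \<not> avoids v v e) xs)"
      and vw: "edge (xs ! 0) = {v, w}" "length (filter (avoids v v) xs) \<le> length (filter (avoids w w) xs)"
      and r1: "regs s1 rK = A + 2 * length zs" "regs s1 rSP = regs s rSP + 3"
        "\<forall>r\<in>{rA, rBase, rMode}. regs s1 r = regs s r"
      and m1: "mem s1 (regs s rSP) = A + 2 * length zs" "mem s1 (regs s rSP + 1) = A + 2 * length xs"
       "mem s1 (regs s rSP + 2) = A + 2 * length zs"
       "\<forall>a < regs s rSP. \<not> (A \<le> a \<and> a < A + 2 * length xs) \<longrightarrow> mem s1 a = mem s a"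
      and o1: "out s1 = out s"
      unfolding opened_def by blast
    have e0: "xs ! 0 \<in> set xs" using False by simp
    note loss = sum_loss_cases[OF zs ys e0 vw(1) fr(11) vw(2)]
    have zy: "mset xs = mset (zs @ ys)" using zs ys by simp
    then have len: "length xs = length zs + length ys" by (metis mset_eq_length length_append)
    have szy: "set xs = set zs \<union> set ys" using zy by (metis set_append set_mset_mset)
    have vz: "\<forall>e\<in>set zs. v \<notin> edge e" and vy: "\<forall>e\<in>set ys. v \<in> edge e"
    proof -
      have "set ys = set (filter (\<lambda>e. \<not> avoids v v e) xs)" "set zs = set (filter (avoids v v) xs)"
        using zs ys by (metis set_mset_mset)+
      then show "\<forall>e\<in>set zs. v \<notin> edge e" "\<forall>e\<in>set ys. v \<in> edge e" by (auto simp: avoids_edge)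
    qed
    have pzy: "proper (zs @ ys)" using proper_mset[OF zy] fr(11) by blast
    then have pz: "proper zs" by (auto simp: proper_def)
    have lt: "length zs < length xs" using len loss(1) by simp
    have SP3: "regs s rSP + 3 + 3 * length zs \<le> S" using fr(8) lt by linarith
    have "calling W S A B zs s1"
      unfolding calling_def using r1 fr SP3 pa1 len szy pz by (auto simp: pairs_at_append)
    then obtain t2 s2 where t2: "reaches W S s1 t2 s2" and "returned A zs s1 t2 s2"
      using less.hyps[OF lt] by blast
    then obtain zs' ws2 Ns2 where zs': "mset zs' = mset zs" "pairs_at (mem s2) A zs'"
      and o2: "out s2 = out s1 @ ws2" and Ns2: "distinct Ns2" "set Ns2 = {N. matching (edges zs) N}"
      and tr2: "\<And>M. M \<inter> edges zs = {} \<Longrightarrow> transforms M ws2 (map ((\<union>) M) Ns2) M"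
      and c2: "t2 + 126 * length zs + 340 \<le> 345 * length Ns2"
      and r2: "regs s2 rMode = 1" "\<forall>r\<in>{rA, rBase, rSP}. regs s2 r = regs s1 r"
      and m2: "\<forall>a < regs s1 rSP. \<not> (A \<le> a \<and> a < A + 2 * length zs) \<longrightarrow> mem s2 a = mem s1 a"
      unfolding returned_def by blast
    let ?p = "regs s rSP"
    have lz': "length zs' = length zs" using zs'(1) by (rule mset_eq_length)
    have zy': "mset (zs' @ ys) = mset xs" using zs'(1) zy by simp
    have "pairs_at (mem s1) (A + 2 * length zs') ys"
      using pa1 lz' by (simp add: pairs_at_append)
    then have "pairs_at (mem s2) (A + 2 * length zs') ys"
      by (rule pairs_at_cong) (use m2 r1 fr len lz' in auto)
    then have pa2: "pairs_at (mem s2) A (zs' @ ys)"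
      using zs'(2) by (simp add: pairs_at_append)
    have m2': "mem s2 ?p = A + 2 * length zs" "mem s2 (?p + 1) = A + 2 * length xs"
       "mem s2 (?p + 2) = A + 2 * length zs"
      using m2 m1 r1 fr len by auto
    have "\<forall>e \<in> set (zs' @ [] @ ys). fst e < W \<and> snd e < W"
      using fr(10) zy' by (metis append_Nil set_mset_mset)
    then have "frame_at W S A B ?p zs' [] ys s2"
      unfolding frame_at_def using r2 r1 fr(1-9) m2' pa2 lz' len SP3 by (intro conjI) simp_all
    moreover have "proper (zs' @ [] @ ys)" using proper_mset[OF zy'] fr(11) by simp
    ultimately obtain t3 s3 where t3: "reaches W S s2 t3 s3" and "frame_done A ?p zs' [] ys s2 t3 s3"
      using frame_loop[of "length zs" W S A B ?p zs' "[]" ys s2] less.hyps lt lz' by force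
    then obtain zs3 ws3 Ns3 where zs3: "mset zs3 = mset zs'" "pairs_at (mem s3) A (zs3 @ ys)"
      and o3: "out s3 = out s2 @ ws3" and Ns3: "distinct Ns3" "set Ns3 = (\<Union>e\<in>set ys. branch zs' e)"
      and tr3: "\<And>M. M \<inter> edges (zs' @ ys) = {} \<Longrightarrow> transforms M ws3 (map ((\<union>) M) Ns3) M"
      and c3: "t3 + (\<Sum>e\<leftarrow>ys. 126 * length (filter (disjoint_edges e) zs') + 340)
       \<le> 345 * length Ns3 + length ys * (21 * length zs' + 42) + 32"
      and r3: "regs s3 rMode = 1" "\<forall>r\<in>{rA, rBase}. regs s3 r = regs s2 r" "regs s3 rSP = ?p"
      and m3: "\<forall>a < ?p. \<not> (A \<le> a \<and> a < A + 2 * length zs') \<longrightarrow> mem s3 a = mem s2 a"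
      unfolding frame_done_def by auto
    let ?Ns = "Ns2 @ Ns3"
    have "set ?Ns = {N. matching (edges xs) N}"
      using matching_branch[OF vy vz, of xs] zy Ns2(2) Ns3(2) branch_mset[OF zs'(1)] by simp
    moreover have "distinct ?Ns"
    proof -
      \<comment> \<open>Matchings of the first child use no edge at \<open>v\<close>, all the others
        contain one.\<close>
      have "N \<notin> set Ns3" if "N \<in> set Ns2" for N
      proof
        assume "N \<in> set Ns3"
        then obtain e where "e \<in> set ys" "edge e \<in> N" using Ns3(2) branch_member(1) by blast
        moreover have "N \<subseteq> edges zs" using that Ns2(2) by (auto simp: matching_def)
        ultimately show False using vy vz by (auto simp: edges_def)
      qed
      then show ?thesis using Ns2(1) Ns3(1) by auto
    qed
    moreover have "transforms M (ws2 @ ws3) (map ((\<union>) M) ?Ns) M" if M: "M \<inter> edges xs = {}" for M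
    proof -
      have "edges (zs' @ ys) = edges xs" "edges xs = edges zs \<union> edges ys"
        using edges_mset[OF zy'] edges_mset[OF zy] by (simp_all add: edges_append)
      then have "M \<inter> edges zs = {}" "M \<inter> edges (zs' @ ys) = {}" using M by auto
      then show ?thesis using transforms_append[OF tr2 tr3] by simp
    qed
    moreover have "mset (zs3 @ ys) = mset xs" using zs3(1) zy' by simp
    moreover have "out s3 = out s @ (ws2 @ ws3)" using o1 o2 o3 by simp
    moreover have "(1 + t1 + t2 + t3) + 126 * length xs + 340 \<le> 345 * length ?Ns"
    proof -
      \<comment> \<open>For each edge, kept and lost edges add up to \<open>length zs\<close>, so
        the left-over credit of the children is expressed by the total loss.\<close>
      have "(\<Sum>e\<leftarrow>us. 126 * length (filter (disjoint_edges e) zs') + 340) + 126 * sum_list (map (loss zs) us)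
          = 126 * (length us * length zs) + 340 * length us" for us
      proof (induction us)
        case (Cons e us)
        have "loss zs e + length (filter (disjoint_edges e) zs') = length zs"
          using loss_eq[of zs' e] loss_mset[OF zs'(1)] lz' by simp
        then show ?case using Cons by (simp add: algebra_simps)
      qed simp
      from this[of ys] c3 have "t3 + 126 * (length ys * length zs) + 340 * length ys \<le>
         345 * length Ns3 + 126 * sum_list (map (loss zs) ys) + length ys * (21 * length zs + 42) + 32"
        unfolding lz' by linarith
      from node_cost[OF _ loss(2-4) c2 this] loss(1) t1(2) show ?thesis
        unfolding len by simp
    qed
    moreover have "\<forall>a < ?p. \<not> (A \<le> a \<and> a < A + 2 * length xs) \<longrightarrow> mem s3 a = mem s a"
      using m3 m2 m1(4) r1(2) len lz' by auto
    ultimately have "returned A xs s (1 + t1 + t2 + t3) s3"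
      unfolding returned_def using r3 r2(2) r1(3) zs3(2)
      by (intro conjI exI[of _ "zs3 @ ys"] exI[of _ "ws2 @ ws3"] exI[of _ ?Ns]) auto
    moreover have "reaches W S s (1 + t1 + t2 + t3) s3"
      using reaches_trans[OF reaches_trans[OF t1(1) t2] t3] .
    ultimately show ?thesis by blast
  qed
qed

subsection \<open>Reading the graph\<close>

abbreviation (input) rn :: nat where "rn \<equiv> 23"
abbreviation (input) rp :: nat where "rp \<equiv> 24"
abbreviation (input) rEnd :: nat where "rEnd \<equiv> 25"
abbreviation (input) rLists :: nat where "rLists \<equiv> 26"
abbreviation (input) rw :: nat where "rw \<equiv> 27"
abbreviation (input) ru :: nat where "ru \<equiv> 28"
abbreviation (input) rj :: nat where "rj \<equiv> 29"
abbreviation (input) ro :: nat where "ro \<equiv> 30"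

text \<open>The \<open>j\<close>-th occurrence of \<open>w\<close> in the concatenated lists, counted in the (initially zero) memory
  behind the input, is taken to stand for the \<open>j\<close>-th neighbour of \<open>w\<close>. As \<open>w\<close> occurs as often as it
  has neighbours, this visits every ordered pair of adjacent vertices once.\<close>

definition setup_body :: com where
  "setup_body =
     Load rw (Reg rp) ;; Add ro (Reg rEnd) (Reg rw) ;; Load rj (Reg ro) ;;
     Add rt (Reg rj) (Const 1) ;; Store (Reg ro) (Reg rt) ;;
     Add ro (Reg rw) (Const 1) ;; Load ro (Reg ro) ;; Add ro (Reg ro) (Reg rj) ;;
     Add ro (Reg ro) (Reg rLists) ;; Load ru (Reg ro) ;;
     IfElse (Less (Reg rw) (Reg ru))
       (Store (Reg rK) (Reg rw) ;; Add rt (Reg rK) (Const 1) ;; Store (Reg rt) (Reg ru) ;;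
        Add rK (Reg rK) (Const 2))
       Skip ;;
     Add rp (Reg rp) (Const 1)"

text \<open>The memory holds the input, then one counter per vertex, the edge array, and the stack.
  The counters are never initialised explicitly, since fresh memory is zero; no loop runs over the
  vertices.\<close>

definition setup_graph :: com where
  "setup_graph =
     Load rn (Const 0) ;; Add rLists (Reg rn) (Const 1) ;; Load rEnd (Reg rLists) ;;
     Add rLists (Reg rLists) (Const 1) ;; move rp (Reg rLists) ;;
     Add rEnd (Reg rLists) (Reg rEnd) ;; Add rA (Reg rEnd) (Reg rn) ;; move rK (Reg rA) ;;
     While (Less (Reg rp) (Reg rEnd)) setup_body ;;
     move rBase (Reg rK) ;; move rSP (Reg rK)"

section \<open>Occurrences in the concatenated adjacency lists\<close>

definition offset :: "nat list list \<Rightarrow> nat \<Rightarrow> nat" where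
  "offset adj v = sum_list (map length (take v adj))"

lemma nth_concat_offset:
  assumes "v < length adj" "j < length (adj ! v)"
  shows "offset adj v + j < length (concat adj)" "concat adj ! (offset adj v + j) = adj ! v ! j"
proof -
  have "concat adj = concat (take v adj) @ adj ! v @ concat (drop (Suc v) adj)"
    using assms(1) by (metis append_assoc concat.simps(2) concat_append id_take_nth_drop)
  moreover have "length (concat (take v adj)) = offset adj v"
    by (simp add: offset_def length_concat)
  ultimately show "offset adj v + j < length (concat adj)" "concat adj ! (offset adj v + j) = adj ! v ! j"
    using assms(2) by (simp_all add: nth_append)
qed

lemma encode_nth:
  fixes adj :: "nat list list"
  defines "n \<equiv> length adj"
  shows "length (encode adj) = n + 2 + length (concat adj)"
    "encode adj ! 0 = n"
    "v \<le> n \<Longrightarrow> encode adj ! Suc v = offset adj v"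
    "i < length (concat adj) \<Longrightarrow> encode adj ! (n + 2 + i) = concat adj ! i"
proof -
  show "v \<le> n \<Longrightarrow> encode adj ! Suc v = offset adj v"
    unfolding encode_def n_def offset_def
    by (simp add: nth_append del: upt_Suc)
  show "i < length (concat adj) \<Longrightarrow> encode adj ! (n + 2 + i) = concat adj ! i"
    unfolding encode_def n_def
    by (simp add: nth_append del: upt_Suc)
qed (simp_all add: encode_def n_def del: upt_Suc)

text \<open>The edges found after reading \<open>i\<close> list entries;
  \<open>w < adj ! w ! j\<close> keeps one orientation of each edge.\<close>

definition listed :: "nat list list \<Rightarrow> nat \<Rightarrow> (nat \<times> nat) set" where
  "listed adj i = {(w, adj ! w ! j) |w j. w < length adj \<and>
     j < count_list (take i (concat adj)) w \<and> w < adj ! w ! j}"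

text \<open>\<open>k\<close> entries remain to be read, and the counter of \<open>w\<close> equals
  its number of occurrences so far. At most one edge is stored per entry read, which keeps the array
  within the memory.\<close>

definition setup_inv :: "nat list list \<Rightarrow> nat \<Rightarrow> state \<Rightarrow> bool" where
  "setup_inv adj k s \<longleftrightarrow> (\<exists>n T xs. n = length adj \<and> T = length (concat adj) \<and> k \<le> T \<and>
     regs s rMode = 0 \<and> regs s rLists = n + 2 \<and> regs s rEnd = n + 2 + T \<and> regs s rA = 2 * n + 2 + T \<and>
     regs s rp = n + 2 + (T - k) \<and> regs s rK = 2 * n + 2 + T + 2 * length xs \<and>
     pairs_at (mem s) (2 * n + 2 + T) xs \<and> distinct xs \<and> set xs = listed adj (T - k) \<and>
     length xs \<le> T - k \<and>
     (\<forall>a < n + 2 + T. mem s a = encode adj ! a) \<and>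
     (\<forall>w < n. mem s (n + 2 + T + w) = count_list (take (T - k) (concat adj)) w) \<and> out s = [])"

lemma setup_step:
  assumes inv: "setup_inv adj (Suc k) s"
    and adj: "\<forall>w < length adj. distinct (adj ! w)"
      "\<forall>w < length adj. count_list (concat adj) w = length (adj ! w)"
      "\<forall>w \<in> set (concat adj). w < length adj"
    and bnd: "2 * length adj + 4 + 3 * length (concat adj) \<le> S" "S + 4 \<le> W"
  shows "holds s (Less (Reg rp) (Reg rEnd)) \<and>
    wp W S setup_body (\<lambda>t s'. t \<le> 19 \<and> setup_inv adj k s') s"
proof -
  define n T i where "n = length adj" "T = length (concat adj)" "i = T - Suc k"
  from inv obtain xs where k: "Suc k \<le> T" and r: "regs s rMode = 0" "regs s rLists = n + 2"
     "regs s rEnd = n + 2 + T" "regs s rA = 2 * n + 2 + T"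
     "regs s rp = n + 2 + i" "regs s rK = 2 * n + 2 + T + 2 * length xs"
    and xs: "pairs_at (mem s) (2 * n + 2 + T) xs" "distinct xs" "set xs = listed adj i" "length xs \<le> i"
    and m: "\<And>a. a < n + 2 + T \<Longrightarrow> mem s a = encode adj ! a"
     "\<And>w. w < n \<Longrightarrow> mem s (n + 2 + T + w) = count_list (take i (concat adj)) w" and o: "out s = []"
    unfolding setup_inv_def n_T_i_def by blast
  have i: "i < T" "T - k = Suc i" using k by (auto simp: n_T_i_def)
  define w j where "w = concat adj ! i" "j = count_list (take i (concat adj)) w"
  define u where "u = adj ! w ! j"
  have "w \<in> set (concat adj)" unfolding w_j_def using i by (intro nth_mem) (simp add: n_T_i_def)
  then have w: "w < n" using adj(3) unfolding n_T_i_def by blast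
  have take: "take (Suc i) (concat adj) = take i (concat adj) @ [w]"
    using i by (simp add: w_j_def n_T_i_def take_Suc_conv_app_nth)
  have "count_list (concat adj) w = count_list (take (Suc i) (concat adj)) w + count_list (drop (Suc i) (concat adj)) w"
    by (metis append_take_drop_id count_list_append)
  \<comment> \<open>The present occurrence of \<open>w\<close> is not among the \<open>j\<close>
    earlier ones; hence the strict inequality, which makes \<open>j\<close> a valid index into the
    list of \<open>w\<close>.\<close>
  then have "j < count_list (concat adj) w"
    unfolding take by (simp add: w_j_def)
  then have j: "j < length (adj ! w)" using adj(2) w by (simp add: n_T_i_def)
  note nc = nth_concat_offset[OF w[unfolded n_T_i_def] j]
  have jT: "offset adj w + j < T" using nc(1) by (simp add: n_T_i_def)
  have m1: "mem s (n + 2 + i) = w"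
    using m(1)[of "n + 2 + i"] encode_nth(4)[of i adj] i by (simp add: n_T_i_def w_j_def)
  have m2: "mem s (n + 2 + T + w) = j" using m(2)[OF w] by (simp add: w_j_def)
  have m3: "mem s (Suc w) = offset adj w"
    using m(1)[of "Suc w"] encode_nth(3)[of w adj] w by (simp add: n_T_i_def)
  have m4: "mem s (offset adj w + j + (n + 2)) = u"
    using m(1)[of "n + 2 + (offset adj w + j)"] encode_nth(4)[of "offset adj w + j" adj] jT nc(2)
    by (simp add: n_T_i_def u_def algebra_simps)
  have "u \<in> set (concat adj)" using nc by (metis nth_mem u_def)
  then have u: "u < n" using adj(3) unfolding n_T_i_def by blast
  let ?A = "2 * n + 2 + T"
  have count: "count_list (take (Suc i) (concat adj)) v = (count_list (take i (concat adj)) v) + (if v = w then 1 else 0)" for v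
    unfolding take by simp
  have listed_Suc: "listed adj (Suc i) = listed adj i \<union> (if w < u then {(w, u)} else {})"
    unfolding listed_def count using w
    by (auto simp: w_j_def u_def n_T_i_def less_Suc_eq split: if_splits)
  \<comment> \<open>Earlier visits to \<open>w\<close> used smaller indices, and a distinct list
    gives different neighbours there.\<close>
  have new: "(w, u) \<notin> listed adj i"
  proof
    assume "(w, u) \<in> listed adj i"
    then obtain j' where "j' < j" "adj ! w ! j' = adj ! w ! j"
      unfolding listed_def w_j_def u_def by auto
    then show False using adj(1) w j nth_eq_iff_index_eq[of "adj ! w" j' j] by (auto simp: n_T_i_def)
  qed
  define xs' where "xs' = xs @ (if w < u then [(w, u)] else [])"
  have xs': "distinct xs'" "set xs' = listed adj (Suc i)" "length xs' \<le> Suc i"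
    using xs new unfolding xs'_def listed_Suc by auto
  have fin: "setup_inv adj k s'"
    if "\<forall>r\<in>{rMode, rLists, rEnd, rA}. regs s' r = regs s r" "regs s' rp = n + 2 + Suc i"
      "regs s' rK = ?A + 2 * length xs'" "out s' = []"
      "mem s' = (if w < u
        then (mem s)(n + 2 + T + w := Suc j, ?A + 2 * length xs := w, Suc (?A + 2 * length xs) := u)
        else (mem s)(n + 2 + T + w := Suc j))" for s'
  proof -
    have pa: "pairs_at (mem s') ?A xs'"
      unfolding xs'_def pairs_at_append
    proof
      show "pairs_at (mem s') ?A xs"
        by (rule pairs_at_cong[OF xs(1)]) (use that(5) w in auto)
      show "pairs_at (mem s') (?A + 2 * length xs) (if w < u then [(w, u)] else [])"
        using that(5) by (auto simp: pairs_at_def)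
    qed
    have "\<forall>a < n + 2 + T. mem s' a = encode adj ! a"
      using m(1) that(5) by auto
    moreover have "\<forall>v < n. mem s' (n + 2 + T + v) = count_list (take (Suc i) (concat adj)) v"
      using m(2) that(5) by (auto simp: count w_j_def)
    ultimately show ?thesis
      unfolding setup_inv_def
      using that(1-4) pa xs' i r n_T_i_def(1,2)
      by - (rule exI[of _ n], rule exI[of _ T], rule exI[of _ xs'], simp)
  qed
  have bn: "2 * n + 4 + 3 * T \<le> S" using bnd(1) by (simp add: n_T_i_def)
  have jT': "j < T" "offset adj w < T" using jT by auto
  \<comment> \<open>The counter is written before the start index and the neighbour are loaded, so
    these addresses must differ from its own.\<close>
  have ne: "Suc w \<noteq> n + 2 + T + w" "offset adj w + j + (n + 2) \<noteq> n + 2 + T + w"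
    using jT by linarith+
  show ?thesis
  proof (cases "w < u")
    case True
    then show ?thesis
      using bn bnd(2) w u i xs(4) jT jT' ne
      apply (simp add: setup_body_def set_reg_def r m1[simplified] m2[simplified] m3 m4[simplified])
      apply (rule fin)
      using r by (simp_all add: xs'_def o)
  next
    case False
    then show ?thesis
      using bn bnd(2) w u i xs(4) jT jT' ne
      apply (simp add: setup_body_def set_reg_def r m1[simplified] m2[simplified] m3 m4[simplified])
      apply (rule fin)
      using r by (simp_all add: xs'_def o)
  qed
qed


definition graph_ready :: "nat \<Rightarrow> (nat \<times> nat) list \<Rightarrow> state \<Rightarrow> bool" where
  "graph_ready A xs s \<longleftrightarrow> regs s rMode = 0 \<and> regs s rA = A \<and> pairs_at (mem s) A xs \<and>
     regs s rK = A + 2 * length xs \<and> regs s rBase = A + 2 * length xs \<and>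
     regs s rSP = A + 2 * length xs \<and> out s = []"

text \<open>The time depends only on the total length \<open>T\<close> of the lists, so isolated
  vertices cost nothing.\<close>

lemma wp_setup_graph:
  fixes adj :: "nat list list"
  defines "n \<equiv> length adj" and "T \<equiv> length (concat adj)"
  assumes adj: "\<forall>w < length adj. distinct (adj ! w)"
      "\<forall>w < length adj. count_list (concat adj) w = length (adj ! w)"
      "\<forall>w \<in> set (concat adj). w < length adj"
    and bnd: "2 * n + 4 + 3 * T \<le> S" "S + 4 \<le> W"
  shows "wp W S setup_graph (\<lambda>t s. t \<le> 20 * T + 20 \<and>
    (\<exists>xs. distinct xs \<and> set xs = listed adj T \<and> graph_ready (2 * n + 2 + T) xs s)) (initial (encode adj))"
proof -
  let ?A = "2 * n + 2 + T"
  define s0 where "s0 = initial (encode adj)"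
  have m0: "mem s0 0 = n" "mem s0 (Suc n) = T"
    using encode_nth(1,2)[of adj] encode_nth(3)[of n adj]
    by (simp_all add: s0_def initial_def n_def T_def offset_def length_concat)
  have m1: "mem s0 a = encode adj ! a" if "a < n + 2 + T" for a
    using that encode_nth(1)[of adj] by (simp add: s0_def initial_def n_def T_def)
  have m2: "mem s0 (n + 2 + T + w) = 0" for w
    using encode_nth(1)[of adj] by (simp add: s0_def initial_def n_def T_def)
  have s0: "regs s0 r = 0" "out s0 = []" for r by (simp_all add: s0_def initial_def)
  obtain R where R: "R = While (Less (Reg rp) (Reg rEnd)) setup_body ;; move rBase (Reg rK) ;; move rSP (Reg rK)"
    by blast
  have loop: "wp W S R (\<lambda>t s. 8 + t \<le> 20 * T + 20 \<and>
    (\<exists>xs. distinct xs \<and> set xs = listed adj T \<and> graph_ready ?A xs s)) s1"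
    if s1: "regs s1 rMode = 0" "regs s1 rLists = n + 2" "regs s1 rEnd = n + 2 + T" "regs s1 rA = ?A"
       "regs s1 rp = n + 2" "regs s1 rK = ?A" "mem s1 = mem s0" "out s1 = []" for s1
  proof -
    have inv: "setup_inv adj T s1"
      unfolding setup_inv_def
      apply (rule exI[of _ n], rule exI[of _ T], rule exI[of _ "[]"])
      using s1 m1 m2 by (simp add: n_def T_def pairs_at_def listed_def)
    have "wp W S (While (Less (Reg rp) (Reg rEnd)) setup_body)
        (\<lambda>t s'. t \<le> 1 + (19 + 1) * T \<and> setup_inv adj 0 s') s1"
    proof (rule wp_for[where I = "setup_inv adj"])
      fix k s assume "setup_inv adj (Suc k) s"
      then show "holds s (Less (Reg rp) (Reg rEnd)) \<and>
          wp W S setup_body (\<lambda>t s'. t \<le> 19 \<and> setup_inv adj k s') s"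
        by (rule setup_step[OF _ adj]) (use bnd in \<open>simp_all add: n_def T_def\<close>)
    next
      fix s assume "setup_inv adj 0 s"
      then show "\<not> holds s (Less (Reg rp) (Reg rEnd))"
        by (auto simp: setup_inv_def)
    qed (rule inv)
    then show ?thesis
      unfolding R wp_Seq
    proof (rule wp_mono)
      fix t s2 assume *: "t \<le> 1 + (19 + 1) * T \<and> setup_inv adj 0 s2"
      then obtain xs where xs: "distinct xs" "set xs = listed adj T" "pairs_at (mem s2) ?A xs" "length xs \<le> T"
        and r: "regs s2 rMode = 0" "regs s2 rA = ?A" "regs s2 rK = ?A + 2 * length xs" "out s2 = []"
        unfolding setup_inv_def by (auto simp: n_def T_def)
      have "?A + 2 * length xs < W" using bnd xs(4) by linarith
      moreover have "graph_ready ?A xs s3"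
        if "s3 = set_reg rSP (regs s2 rK) (set_reg rBase (regs s2 rK) s2)" for s3
        using that xs r by (simp add: graph_ready_def set_reg_def)
      ultimately show "wp W S (move rBase (Reg rK)) (\<lambda>t'. wp W S (move rSP (Reg rK)) (\<lambda>t'' s.
         8 + (t + (t' + t'')) \<le> 20 * T + 20 \<and>
         (\<exists>xs. distinct xs \<and> set xs = listed adj T \<and> graph_ready ?A xs s))) s2"
        using * xs(1,2) r by (auto simp: move_def set_reg_def intro!: exI[of _ xs])
    qed
  qed
  show ?thesis
    unfolding setup_graph_def R[symmetric] s0_def[symmetric]
    using bnd
    apply (simp add: set_reg_def move_def m0 s0)
    apply (rule wp_mono[OF loop])
    by (simp_all add: s0)
qed

section \<open>Counting in adjacency lists\<close>

lemma count_list_distinct: "distinct xs \<Longrightarrow> count_list xs w = of_bool (w \<in> set xs)"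
  by (induction xs) auto

lemma count_list_concat: "count_list (concat xss) w = (\<Sum>v<length xss. count_list (xss ! v) w)"
proof -
  have "count_list (concat xss) w = sum_list (map (\<lambda>xs. count_list xs w) xss)"
    by (induction xss) auto
  then show ?thesis by (simp add: sum_list_sum_nth atLeast0LessThan)
qed

text \<open>By symmetry of adjacency, \<open>w\<close> occurs once in the list of each neighbour, so
  its occurrences match the length of its own list. Every edge gives two ordered pairs, which bounds
  the total length.\<close>

lemma adjacency_lists_facts:
  assumes G: "simple_graph V E" and adj: "adjacency_lists V E adj"
  shows "\<forall>w < length adj. distinct (adj ! w)"
    and "\<forall>w < length adj. count_list (concat adj) w = length (adj ! w)"
    and "\<forall>w \<in> set (concat adj). w < length adj"
    and "listed adj (length (concat adj)) = {(w, u). w < u \<and> {w, u} \<in> E}"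
    and "finite E" and "length (concat adj) \<le> 2 * card E"
proof -
  have V: "V = {..<length adj}" and d: "\<And>w. w < length adj \<Longrightarrow> distinct (adj ! w)"
    and s: "\<And>w. w < length adj \<Longrightarrow> set (adj ! w) = {u. {u, w} \<in> E}"
    using adj unfolding adjacency_lists_def by auto
  have EV: "u < length adj" "w < length adj" if "{u, w} \<in> E" for u w
    using G that V unfolding simple_graph_def by auto
  have E2: "u \<noteq> w" if "{u, w} \<in> E" for u w
    using G that unfolding simple_graph_def by fastforce
  show dist: "\<forall>w < length adj. distinct (adj ! w)" using d by blast
  show "\<forall>w \<in> set (concat adj). w < length adj"
    using s EV by (force simp: in_set_conv_nth[of _ adj])
  show count: "\<forall>w < length adj. count_list (concat adj) w = length (adj ! w)"
  proof (intro allI impI)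
    fix w assume w: "w < length adj"
    have "count_list (concat adj) w = (\<Sum>v<length adj. of_bool (w \<in> set (adj ! v)))"
      unfolding count_list_concat using d by (intro sum.cong) (simp_all add: count_list_distinct)
    also have "\<dots> = card {v. v < length adj \<and> w \<in> set (adj ! v)}"
      by (simp add: of_bool_def sum.If_cases Int_def)
    also have "{v. v < length adj \<and> w \<in> set (adj ! v)} = set (adj ! w)"
      using s w EV by (auto simp: insert_commute)
    finally show "count_list (concat adj) w = length (adj ! w)"
      using d[OF w] by (simp add: distinct_card)
  qed
  show "listed adj (length (concat adj)) = {(w, u). w < u \<and> {w, u} \<in> E}" (is "_ = ?P")
  proof -
    have "listed adj (length (concat adj)) = {(w, u). w < length adj \<and> u \<in> set (adj ! w) \<and> w < u}"
      unfolding listed_def using count by (auto simp: in_set_conv_nth)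
    then show ?thesis using s EV by (auto simp: insert_commute)
  qed
  show finE: "finite E"
  proof (rule finite_subset)
    show "E \<subseteq> Pow V" using G by (auto simp: simple_graph_def)
  qed (simp add: V)
  have finP: "finite ?P"
    by (rule finite_subset[of _ "V \<times> V"]) (use EV V in auto)
  have "inj_on (\<lambda>(w, u). {w, u}) ?P" by (auto simp: inj_on_def doubleton_eq_iff)
  then have P: "card ?P \<le> card E"
    by (rule card_inj_on_le) (use finE in auto)
  have sub: "(SIGMA v:{..<length adj}. set (adj ! v)) \<subseteq> ?P \<union> prod.swap ` ?P"
  proof
    fix x assume "x \<in> (SIGMA v:{..<length adj}. set (adj ! v))"
    then obtain v u where x: "x = (v, u)" "{u, v} \<in> E" using s by auto
    then have "u \<noteq> v" using E2 by blast
    then show "x \<in> ?P \<union> prod.swap ` ?P"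
      using x by (cases "v < u") (auto simp: insert_commute image_iff)
  qed
  have "length (concat adj) = (\<Sum>v<length adj. length (adj ! v))"
    by (simp add: length_concat sum_list_sum_nth atLeast0LessThan)
  also have "\<dots> = (\<Sum>v<length adj. card (set (adj ! v)))"
    using d by (intro sum.cong) (simp_all add: distinct_card)
  also have "\<dots> = card (SIGMA v:{..<length adj}. set (adj ! v))"
    by (simp add: card_SigmaI)
  also have "card (SIGMA v:{..<length adj}. set (adj ! v)) \<le> card (?P \<union> prod.swap ` ?P)"
    using finP by (intro card_mono sub) auto
  also have "\<dots> \<le> card ?P + card (prod.swap ` ?P)" by (rule card_Un_le)
  also have "\<dots> \<le> 2 * card E" using P card_image_le[OF finP, of prod.swap] by linarith
  finally show "length (concat adj) \<le> 2 * card E" .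
qed

text \<open>Ordering the endpoints of each edge gives a bijection between \<open>E\<close> and the
  increasing pairs.\<close>

lemma edges_of_ordered_pairs:
  assumes G: "simple_graph {..<n} E" and xs: "distinct xs" "set xs = {(w, u). w < u \<and> {w, u} \<in> E}"
  shows "proper xs" "edges xs = E" "length xs = card E" "\<forall>e\<in>set xs. fst e < n \<and> snd e < n"
proof -
  have inj: "inj_on edge (set xs)"
    unfolding xs(2) by (auto simp: inj_on_def edge_def doubleton_eq_iff)
  show "proper xs"
    unfolding proper_def using xs inj by (auto simp: distinct_map)
  show E: "edges xs = E"
  proof
    show "E \<subseteq> edges xs"
    proof
      fix e assume e: "e \<in> E"
      then have "card e = 2" using G by (auto simp: simple_graph_def)
      then obtain a b where ab: "e = {a, b}" "a \<noteq> b" by (auto simp: card_2_iff)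
      then have "e = edge (min a b, max a b)" "(min a b, max a b) \<in> set xs"
        using e unfolding xs(2) by (auto simp: edge_def min_def max_def insert_commute)
      then show "e \<in> edges xs" by (auto simp: edges_def)
    qed
  qed (auto simp: edges_def edge_def xs(2))
  show "length xs = card E"
    using card_image[OF inj] distinct_card[OF xs(1)] E by (simp add: edges_def)
  show "\<forall>e\<in>set xs. fst e < n \<and> snd e < n"
    using G unfolding xs(2) simple_graph_def by auto
qed

section \<open>Assembling reading and enumeration: time, space and word size\<close>

theorem theorem3:
  "\<exists>(P :: com) (time_const :: real) (space_const :: nat) (word_const :: nat).
     \<forall>V E adj.
       simple_graph V E \<and> adjacency_lists V E adj \<longrightarrow>
       (\<exists>t s Ms.
          exec ((card E + card V + 2) ^ word_const) (space_const * (card E + card V + 1))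
            P (initial (encode adj)) t s \<and>
          reports {} (out s) Ms \<and> distinct Ms \<and> set Ms = {M. matching E M} \<and>
          real t / real (card {M. matching E M}) \<le> time_const)"
\<comment> \<open>345 is the credit per matching. With m edges, n vertices and T \<le> 2 m, input,
  counters, array and stack need 2 n + 2 + T + 5 m words, below 10 (m + n + 1). The fifth power
  exceeds the space by 4 already for the base 2.\<close>
proof (rule exI[of _ "setup_graph ;; main_loop"], rule exI[of _ 345], rule exI[of _ 10],
    rule exI[of _ 5], intro allI impI)
  fix V E adj
  assume "simple_graph V E \<and> adjacency_lists V E adj"
  then have G: "simple_graph V E" and adj: "adjacency_lists V E adj" by auto
  define n m T where "n = length adj" "m = card E" "T = length (concat adj)"
  define S W where "S = 10 * (card E + card V + 1)" "W = (card E + card V + 2) ^ 5"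
  note facts = adjacency_lists_facts[OF G adj]
  have V: "V = {..<n}" using adj by (simp add: adjacency_lists_def n_m_T_def)
  then have S: "S = 10 * (m + n + 1)" by (simp add: S_W_def n_m_T_def)
  have T: "T \<le> 2 * m" using facts(6) by (simp add: n_m_T_def)
  have SW: "S + 4 \<le> W"
  proof -
    define x where "x = m + n + 2"
    have "2 ^ 4 \<le> x ^ 4" by (rule power_mono) (simp_all add: x_def)
    then have "16 * x \<le> x ^ 4 * x" by (intro mult_right_mono) simp_all
    moreover have "W = x ^ 4 * x"
    proof -
      have "card E + card V + 2 = x" by (simp add: x_def V n_m_T_def(2))
      then show ?thesis using power_add[of x 4 1] unfolding S_W_def(2) by simp
    qed
    ultimately show ?thesis using S by (simp add: x_def)
  qed
  have "wp W S setup_graph (\<lambda>t s. t \<le> 20 * T + 20 \<and>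
    (\<exists>xs. distinct xs \<and> set xs = listed adj T \<and> graph_ready (2 * n + 2 + T) xs s)) (initial (encode adj))"
    unfolding n_m_T_def
    by (rule wp_setup_graph[OF facts(1-3)]) (use S T SW in \<open>simp_all add: n_m_T_def\<close>)
  then obtain t0 s0 xs where exec0: "exec W S setup_graph (initial (encode adj)) t0 s0" and t0: "t0 \<le> 20 * T + 20"
    and xs: "distinct xs" "set xs = listed adj T" and ready: "graph_ready (2 * n + 2 + T) xs s0"
    unfolding wp_def by blast
  let ?A = "2 * n + 2 + T" and ?B = "2 * n + 2 + T + 2 * length xs"
  have "set xs = {(w, u). w < u \<and> {w, u} \<in> E}" using xs(2) facts(4) by (simp add: n_m_T_def)
  note pairs = edges_of_ordered_pairs[OF G[unfolded V] xs(1) this]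
  have len: "length xs = m" using pairs(3) by (simp add: n_m_T_def)
  have "n < W" using S SW by simp
  then have "\<forall>e\<in>set xs. fst e < W \<and> snd e < W" using pairs(4) by fastforce
  then have "calling W S ?A ?B xs s0"
    unfolding calling_def using ready pairs(1) SW S T len by (simp add: graph_ready_def)
  then obtain t1 s1 where reach: "reaches W S s0 t1 s1" and "returned ?A xs s0 t1 s1"
    using matchings_enumerated by blast
  then obtain ws Ns where out1: "out s1 = out s0 @ ws" and Ns: "distinct Ns" "set Ns = {N. matching E N}"
    and tr: "transforms {} ws (map ((\<union>) {}) Ns) {}"
    and t1: "t1 + 126 * length xs + 340 \<le> 345 * length Ns"
    and r1: "regs s1 rMode = 1" "regs s1 rSP = regs s0 rSP" "regs s1 rBase = regs s0 rBase"
    unfolding returned_def pairs(2) by auto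
  have eq: "regs s1 rSP = regs s1 rBase" using r1 ready by (simp add: graph_ready_def)
  \<comment> \<open>The return from the root finds the stack empty, which sets \<open>rMode\<close>
    to 2 and ends the loop.\<close>
  have "wp W S main_body (\<lambda>t s. t \<le> 3 \<and> regs s rMode = 2 \<and> out s = out s1) s1"
    using r1(1) eq SW by (simp add: main_body_def return_step_def move_def set_reg_def)
  then obtain t2 s2 where s2: "exec W S main_body s1 t2 s2" "t2 \<le> 3" "regs s2 rMode = 2" "out s2 = out s1"
    unfolding wp_def by blast
  have "exec W S main_loop s2 1 s2"
    unfolding main_loop_def by (rule WhileFalse) (simp add: s2(3))
  then have "exec W S main_loop s1 (1 + t2 + 1) s2"
    unfolding main_loop_def using r1(1) by (intro WhileTrue[OF _ s2(1)]) simp_all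
  then have "exec W S main_loop s0 (t1 + (1 + t2 + 1)) s2"
    using reach unfolding reaches_def by blast
  then have exec: "exec W S (setup_graph ;; main_loop) (initial (encode adj)) (t0 + (t1 + (1 + t2 + 1))) s2"
    using exec0 exec.Seq by blast
  have "map ((\<union>) {}) Ns = Ns" by (simp add: map_idI)
  moreover have "out s2 = ws" using s2(4) out1 ready by (simp add: graph_ready_def)
  ultimately have reports: "reports {} (out s2) Ns"
    using transforms_reports[OF tr] by simp
  have card: "card {M. matching E M} = length Ns" using Ns distinct_card by metis
  \<comment> \<open>Reading costs at most 40 m + 20 units for m edges; it and the final iteration
    are paid from the credit 126 m + 340 left unspent at the root.\<close>
  have "t0 + (t1 + (1 + t2 + 1)) \<le> 345 * length Ns"
    using t0 t1 s2(2) T len by linarith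
  then have "real (t0 + (t1 + (1 + t2 + 1))) \<le> 345 * real (length Ns)"
    by (metis of_nat_le_iff of_nat_mult of_nat_numeral)
  moreover have "length Ns > 0" using t1 by (cases Ns) auto
  ultimately have "real (t0 + (t1 + (1 + t2 + 1))) / real (card {M. matching E M}) \<le> 345"
    unfolding card by (simp add: divide_le_eq)
  then show "\<exists>t s Ms. exec ((card E + card V + 2) ^ 5) (10 * (card E + card V + 1))
      (setup_graph ;; main_loop) (initial (encode adj)) t s \<and>
    reports {} (out s) Ms \<and> distinct Ms \<and> set Ms = {M. matching E M} \<and>
    real t / real (card {M. matching E M}) \<le> 345"
    using exec reports Ns unfolding S_W_def by blast
qed

end
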